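(* Let $\widehat X$ be a stationary Poisson hyperplane process in $\mathbb{R}^d$ whose intensity measure $\widehat\Theta$ is locally finite and not identically zero, let $\widehat\varphi$ be its spherical directional distribution, and let $X$ be the mosaic (set of cells) induced by $\widehat X$. Assume (A) the support of $\widehat\varphi$ is the whole unit sphere $\mathbb{S}^{d-1}$, and (B) $\widehat\varphi(u^\perp\cap\mathbb{S}^{d-1})=0$ for every unit vector $u\in\mathbb{S}^{d-1}$ (that is, $\widehat\varphi$ assigns measure zero to each great subsphere). Then, with probability one, the set of all translates $\{C+x : C\in X,\ x\in\mathbb{R}^d\}$ of the cells of $X$ is dense in the space $\mathcal{K}^d$ of convex bodies with respect to the Hausdorff metric.
   Context: $\mathcal{K}^d$ is the set of convex bodies (nonempty, compact, convex subsets) of $\mathbb{R}^d$, with the topology induced by the Hausdorff metric $\delta(K,L)=\min\{\eta\ge 0: K\subset L+\eta B^d,\ L\subset K+\eta B^d\}$, where $B^d$ is the closed unit ball. $\mathcal{H}^d$ is the space of (affine) hyperplanes in $\mathbb{R}^d$ with its usual topology and Borel $\sigma$-algebra $\mathcal{B}(\mathcal{H}^d)$. A stationary Poisson hyperplane process $\widehat X$ is a Poisson point process in $\mathcal{H}^d$ whose distribution is invariant under translations of $\mathbb{R}^d$. Realizations are identified with locally finite systems of hyperplanes (every bounded subset of $\mathbb{R}^d$ is met by only finitely many of them). Its intensity measure is $\widehat\Theta(A)=\mathbb{E}|\widehat X\cap A|$ for $A\in\mathcal{B}(\mathcal{H}^d)$, where $|\cdot|$ is the number of elements. The Poisson property means: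 $\mathbb{P}\{|\widehat X\cap A|=n\}=e^{-\widehat\Theta(A)}\widehat\Theta(A)^n/n!$ for $n\in\mathbb{N}_0$ whenever $\widehat\Theta(A)<\infty$, and the restrictions of $\widehat X$ to pairwise disjoint Borel sets are independent. By stationarity there are a number $\widehat\gamma>0$ and an even Borel probability measure $\widehat\varphi$ on the unit sphere $\mathbb{S}^{d-1}$, called the spherical directional distribution of $\widehat X$, such that $$\widehat\Theta(A)=\widehat\gamma\int_{\mathbb{S}^{d-1}}\int_{-\infty}^{\infty}\mathbf{1}_A(u^\perp+\tau u)\,d\tau\,\widehat\varphi(du),\qquad A\in\mathcal{B}(\mathcal{H}^d),$$ where $u^\perp$ is the hyperplane through $0$ orthogonal to $u$. The cells induced by a locally finite system $\mathcal{H}$ of hyperplanes are the closures of the connected components of $\mathbb{R}^d\setminus\bigcup_{H\in\mathcal{H}}H$. The mosaic $X$ is the (random) set of all cells induced by $\widehat X$. *)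

theory Defs
  imports "HOL-Probability.Probability"
begin

section \<open>The space of hyperplanes\<close>

definition hyperplane :: "'a::euclidean_space \<Rightarrow> real \<Rightarrow> 'a set" where
  "hyperplane u t = {x. u \<bullet> x = t}"

lemma hyperplane_eq_translate:
  assumes "norm u = 1"
  shows "hyperplane u t = (+) (t *\<^sub>R u) ` {x. u \<bullet> x = 0}"
proof -
  have 1: "u \<bullet> u = 1" using assms by (simp add: norm_eq_1)
  show ?thesis
  proof (intro set_eqI iffI)
    fix x assume "x \<in> hyperplane u t"
    then have "u \<bullet> (x - t *\<^sub>R u) = 0" by (simp add: hyperplane_def inner_diff_right 1)
    then show "x \<in> (+) (t *\<^sub>R u) ` {x. u \<bullet> x = 0}"
      by (intro image_eqI[of _ _ "x - t *\<^sub>R u"]) auto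
  qed (auto simp: hyperplane_def inner_add_right 1)
qed

definition hyperplanes :: "'a::euclidean_space set set" where
  "hyperplanes = {hyperplane u t | u t. norm u = 1}"

text \<open>The topology on hyperplanes is the quotient topology of the parametrization
  \<open>(u, t) \<mapsto> hyperplane u t\<close> of hyperplanes by unit normal vector and signed distance from the
  origin (a two-to-one map); see \<open>quotient_map_hyperplane\<close> below.\<close>

definition hyperplane_topology :: "'a::euclidean_space set topology" where
  "hyperplane_topology = topology (\<lambda>U. U \<subseteq> hyperplanes \<and>
     openin (top_of_set (sphere 0 1 \<times> UNIV))
       {p \<in> sphere 0 1 \<times> UNIV. hyperplane (fst p) (snd p) \<in> U})"

lemma openin_hyperplane_topology:
  "openin hyperplane_topology U \<longleftrightarrow> U \<subseteq> hyperplanes \<and>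
     openin (top_of_set (sphere (0::'a::euclidean_space) 1 \<times> UNIV))
       {p \<in> sphere 0 1 \<times> UNIV. hyperplane (fst p) (snd p) \<in> U}"
proof -
  let ?S = "sphere (0::'a) 1 \<times> (UNIV::real set)"
  let ?pre = "\<lambda>U. {p \<in> ?S. hyperplane (fst p) (snd p) \<in> U}"
  have "istopology (\<lambda>U. U \<subseteq> hyperplanes \<and> openin (top_of_set ?S) (?pre U))"
    unfolding istopology_def
  proof (intro conjI allI impI)
    fix U V :: "'a set set"
    assume U: "U \<subseteq> hyperplanes \<and> openin (top_of_set ?S) (?pre U)"
      and V: "V \<subseteq> hyperplanes \<and> openin (top_of_set ?S) (?pre V)"
    show "U \<inter> V \<subseteq> hyperplanes" using U by blast
    have "?pre (U \<inter> V) = ?pre U \<inter> ?pre V" by blast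
    moreover have "openin (top_of_set ?S) (?pre U \<inter> ?pre V)"
      by (rule openin_Int) (rule conjunct2[OF U], rule conjunct2[OF V])
    ultimately show "openin (top_of_set ?S) (?pre (U \<inter> V))" by (simp only:)
  next
    fix \<U> :: "'a set set set"
    assume A: "\<forall>U\<in>\<U>. U \<subseteq> hyperplanes \<and> openin (top_of_set ?S) (?pre U)"
    show "\<Union>\<U> \<subseteq> hyperplanes" using A by blast
    have "?pre (\<Union>\<U>) = \<Union>(?pre ` \<U>)" by blast
    moreover have "openin (top_of_set ?S) (\<Union>(?pre ` \<U>))"
      by (rule openin_Union) (use A in blast)
    ultimately show "openin (top_of_set ?S) (?pre (\<Union>\<U>))" by (simp only:)
  qed
  then show ?thesis
    unfolding hyperplane_topology_def by (simp only: topology_inverse')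
qed

lemma topspace_hyperplane_topology [simp]: "topspace hyperplane_topology = hyperplanes"
proof -
  have "{p \<in> sphere (0::'a) 1 \<times> (UNIV::real set). hyperplane (fst p) (snd p) \<in> hyperplanes}
      = sphere 0 1 \<times> UNIV"
    by (auto simp: hyperplanes_def)
  then have "openin hyperplane_topology (hyperplanes :: 'a set set)"
    by (simp add: openin_hyperplane_topology)
  moreover have "topspace hyperplane_topology \<subseteq> (hyperplanes :: 'a set set)"
    using openin_topspace[of hyperplane_topology] unfolding openin_hyperplane_topology by (rule conjunct1)
  ultimately show ?thesis using openin_subset by (intro subset_antisym)
qed

lemma quotient_map_hyperplane:
  "quotient_map (top_of_set (sphere (0::'a::euclidean_space) 1 \<times> UNIV)) hyperplane_topology
     (\<lambda>p. hyperplane (fst p) (snd p))"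
proof -
  have "(\<lambda>p. hyperplane (fst p) (snd p)) ` (sphere (0::'a) 1 \<times> UNIV) = hyperplanes"
  proof (intro set_eqI iffI)
    fix H :: "'a set"
    assume "H \<in> hyperplanes"
    then obtain u t where "norm u = 1" "H = hyperplane u t" by (auto simp: hyperplanes_def)
    then show "H \<in> (\<lambda>p. hyperplane (fst p) (snd p)) ` (sphere 0 1 \<times> UNIV)"
      by (intro image_eqI[of _ _ "(u, t)"]) auto
  qed (auto simp: hyperplanes_def)
  then show ?thesis
    unfolding quotient_map_def openin_hyperplane_topology
      topspace_hyperplane_topology topspace_euclidean_subtopology
    by blast
qed

definition hyperplane_borel :: "'a::euclidean_space set measure" where
  "hyperplane_borel = sigma hyperplanes {U. openin hyperplane_topology U}"


section \<open>Stationary Poisson hyperplane processes\<close>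

definition locally_finite_systems :: "'a::euclidean_space set set set" where
  "locally_finite_systems =
     {S. S \<subseteq> hyperplanes \<and> (\<forall>B. bounded B \<longrightarrow> finite {H \<in> S. H \<inter> B \<noteq> {}})}"

text \<open>Number of elements, infinite for infinite sets (unlike \<open>card\<close>).\<close>

definition num_elems :: "'b set \<Rightarrow> ennreal" where
  "num_elems S = emeasure (count_space UNIV) S"

definition system_space :: "'a::euclidean_space set set measure" where
  "system_space = sigma locally_finite_systems
     {{S \<in> locally_finite_systems. num_elems (S \<inter> A) \<in> B} | A B.
        A \<in> sets hyperplane_borel \<and> B \<in> sets borel}"

definition hyperplane_process ::
    "'w measure \<Rightarrow> ('w \<Rightarrow> 'a::euclidean_space set set) \<Rightarrow> bool" where
  "hyperplane_process M X \<longleftrightarrow> prob_space M \<and> X \<in> measurable M system_space"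

definition translate_system ::
    "'a::euclidean_space \<Rightarrow> 'a set set \<Rightarrow> 'a set set" where
  "translate_system x S = (\<lambda>H. (+) x ` H) ` S"

definition stationary_process ::
    "'w measure \<Rightarrow> ('w \<Rightarrow> 'a::euclidean_space set set) \<Rightarrow> bool" where
  "stationary_process M X \<longleftrightarrow>
     (\<forall>x. distr M system_space (\<lambda>\<omega>. translate_system x (X \<omega>)) = distr M system_space X)"

definition intensity ::
    "'w measure \<Rightarrow> ('w \<Rightarrow> 'a::euclidean_space set set) \<Rightarrow> 'a set set \<Rightarrow> ennreal" where
  "intensity M X A = (\<integral>\<^sup>+\<omega>. num_elems (X \<omega> \<inter> A) \<partial>M)"

definition poisson_process ::
    "'w measure \<Rightarrow> ('w \<Rightarrow> 'a::euclidean_space set set) \<Rightarrow> bool" where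
  "poisson_process M X \<longleftrightarrow>
     (\<forall>A \<in> sets hyperplane_borel. intensity M X A < \<infinity> \<longrightarrow>
        (\<forall>n::nat. measure M {\<omega> \<in> space M. num_elems (X \<omega> \<inter> A) = of_nat n}
           = exp (- enn2real (intensity M X A)) * enn2real (intensity M X A) ^ n / fact n)) \<and>
     (\<forall>A :: nat \<Rightarrow> 'a set set. range A \<subseteq> sets hyperplane_borel \<and> disjoint_family A \<longrightarrow>
        prob_space.indep_vars M (\<lambda>_. system_space) (\<lambda>i \<omega>. X \<omega> \<inter> A i) UNIV)"

definition stationary_poisson_hyperplane_process ::
    "'w measure \<Rightarrow> ('w \<Rightarrow> 'a::euclidean_space set set) \<Rightarrow> bool" where
  "stationary_poisson_hyperplane_process M X \<longleftrightarrow>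
     hyperplane_process M X \<and> stationary_process M X \<and> poisson_process M X"

definition locally_finite_intensity ::
    "'w measure \<Rightarrow> ('w \<Rightarrow> 'a::euclidean_space set set) \<Rightarrow> bool" where
  "locally_finite_intensity M X \<longleftrightarrow>
     (\<forall>K. compactin hyperplane_topology K \<longrightarrow> intensity M X K < \<infinity>)"


section \<open>Spherical directional distribution\<close>

definition spherical_directional_distribution ::
    "'w measure \<Rightarrow> ('w \<Rightarrow> 'a::euclidean_space set set) \<Rightarrow> 'a measure \<Rightarrow> bool" where
  "spherical_directional_distribution M X \<phi> \<longleftrightarrow>
     prob_space \<phi> \<and> sets \<phi> = sets (restrict_space borel (sphere 0 1)) \<and>
     (\<forall>A \<in> sets \<phi>. emeasure \<phi> (uminus ` A) = emeasure \<phi> A) \<and>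
     (\<exists>\<gamma>>0. \<forall>A \<in> sets hyperplane_borel. intensity M X A =
        ennreal \<gamma> * (\<integral>\<^sup>+u. (\<integral>\<^sup>+t. indicator A (hyperplane u t) \<partial>lborel) \<partial>\<phi>))"

definition measure_support :: "'a::topological_space measure \<Rightarrow> 'a set" where
  "measure_support \<mu> =
     {x \<in> space \<mu>. \<forall>U. open U \<and> x \<in> U \<longrightarrow> emeasure \<mu> (U \<inter> space \<mu>) > 0}"


section \<open>Cells\<close>

definition cells :: "'a::euclidean_space set set \<Rightarrow> 'a set set" where
  "cells S = closure ` components (UNIV - \<Union>S)"

definition translates :: "'a::euclidean_space set set \<Rightarrow> 'a set set" where
  "translates \<C> = {(+) x ` C | C x. C \<in> \<C>}"


section \<open>Convex bodies and the Hausdorff metric\<close>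

definition convex_bodies :: "'a::euclidean_space set set" where
  "convex_bodies = {K. K \<noteq> {} \<and> compact K \<and> convex K}"

text \<open>For convex bodies the infimum is a minimum.  The value 0 off \<open>convex_bodies\<close> is immaterial;
  it only serves the side conditions of \<open>Metric_space\<close>, which are not relativized to the carrier.\<close>

definition hausdorff_distance :: "'a::euclidean_space set \<Rightarrow> 'a set \<Rightarrow> real" where
  "hausdorff_distance K L =
     (if K \<in> convex_bodies \<and> L \<in> convex_bodies
      then Inf {\<eta>. \<eta> \<ge> 0 \<and> K \<subseteq> L + (*\<^sub>R) \<eta> ` cball 0 1 \<and> L \<subseteq> K + (*\<^sub>R) \<eta> ` cball 0 1}
      else 0)"

lemma subset_parallel_body_iff:
  fixes K L :: "'a::euclidean_space set"
  assumes "\<eta> \<ge> 0"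
  shows "K \<subseteq> L + (*\<^sub>R) \<eta> ` cball 0 1 \<longleftrightarrow> (\<forall>x\<in>K. \<exists>y\<in>L. dist x y \<le> \<eta>)"
proof -
  have "x \<in> L + (*\<^sub>R) \<eta> ` cball 0 1 \<longleftrightarrow> (\<exists>y\<in>L. dist x y \<le> \<eta>)" for x
  proof
    assume "x \<in> L + (*\<^sub>R) \<eta> ` cball 0 1"
    then obtain y b where yb: "y \<in> L" "norm b \<le> 1" "x = y + \<eta> *\<^sub>R b"
      by (auto simp: set_plus_def)
    have "dist x y = \<eta> * norm b" using yb assms by (simp add: dist_norm)
    also have "\<dots> \<le> \<eta>" using yb assms by (simp add: mult_left_le)
    finally show "\<exists>y\<in>L. dist x y \<le> \<eta>" using yb by blast
  next
    assume "\<exists>y\<in>L. dist x y \<le> \<eta>"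
    then obtain y where y: "y \<in> L" "norm (x - y) \<le> \<eta>" by (auto simp: dist_norm)
    have "x - y \<in> (*\<^sub>R) \<eta> ` cball 0 1"
    proof (cases "\<eta> = 0")
      case True
      then have "x - y = \<eta> *\<^sub>R 0" using y by simp
      then show ?thesis by (rule image_eqI) simp
    next
      case False
      then have "\<eta> > 0" using assms by simp
      then have "x - y = \<eta> *\<^sub>R ((x - y) /\<^sub>R \<eta>)" "(x - y) /\<^sub>R \<eta> \<in> cball 0 1"
        using y by (simp_all add: divide_simps)
      then show ?thesis by (rule image_eqI)
    qed
    then have "y + (x - y) \<in> L + (*\<^sub>R) \<eta> ` cball 0 1"
      using y by (intro set_plus_intro) auto
    then show "x \<in> L + (*\<^sub>R) \<eta> ` cball 0 1" by simp
  qed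
  then show ?thesis by blast
qed

lemma hausdorff_distance_altdef:
  fixes K L :: "'a::euclidean_space set"
  assumes "K \<in> convex_bodies" "L \<in> convex_bodies"
  shows "hausdorff_distance K L =
    Inf {\<eta>. \<eta> \<ge> 0 \<and> (\<forall>x\<in>K. \<exists>y\<in>L. dist x y \<le> \<eta>) \<and> (\<forall>y\<in>L. \<exists>x\<in>K. dist y x \<le> \<eta>)}"
  using assms unfolding hausdorff_distance_def
  by (simp add: subset_parallel_body_iff cong: conj_cong)

lemma hausdorff_witnesses_nonempty:
  fixes K L :: "'a::euclidean_space set"
  assumes "K \<in> convex_bodies" "L \<in> convex_bodies"
  shows "{\<eta>. \<eta> \<ge> 0 \<and> (\<forall>x\<in>K. \<exists>y\<in>L. dist x y \<le> \<eta>) \<and> (\<forall>y\<in>L. \<exists>x\<in>K. dist y x \<le> \<eta>)} \<noteq> {}"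
proof -
  have ne: "K \<noteq> {}" "L \<noteq> {}" and "bounded (K \<union> L)"
    using assms by (auto simp: convex_bodies_def compact_imp_bounded)
  then obtain e where e: "\<And>x y. x \<in> K \<union> L \<Longrightarrow> y \<in> K \<union> L \<Longrightarrow> dist x y \<le> e"
    unfolding bounded_two_points by blast
  obtain x where "x \<in> K" using ne by blast
  with e[of x x] have "e \<ge> 0" by simp
  moreover have "\<forall>x\<in>K. \<exists>y\<in>L. dist x y \<le> e" "\<forall>y\<in>L. \<exists>x\<in>K. dist y x \<le> e"
    using ne e by (meson UnCI ex_in_conv)+
  ultimately show ?thesis by blast
qed

lemma hausdorff_distance_less_iff:
  fixes K L :: "'a::euclidean_space set"
  assumes "K \<in> convex_bodies" "L \<in> convex_bodies"
  shows "hausdorff_distance K L < e \<longleftrightarrow>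
    (\<exists>\<eta>. 0 \<le> \<eta> \<and> \<eta> < e \<and> (\<forall>x\<in>K. \<exists>y\<in>L. dist x y \<le> \<eta>) \<and> (\<forall>y\<in>L. \<exists>x\<in>K. dist y x \<le> \<eta>))"
  unfolding hausdorff_distance_altdef[OF assms]
proof (subst cInf_less_iff[OF hausdorff_witnesses_nonempty[OF assms]])
  show "bdd_below {\<eta>. \<eta> \<ge> 0 \<and> (\<forall>x\<in>K. \<exists>y\<in>L. dist x y \<le> \<eta>) \<and> (\<forall>y\<in>L. \<exists>x\<in>K. dist y x \<le> \<eta>)}"
    by (rule bdd_belowI[of _ 0]) simp
qed blast

lemma Metric_space_hausdorff:
  "Metric_space (convex_bodies :: 'a::euclidean_space set set) hausdorff_distance"
proof
  fix K L N :: "'a set"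
  show nonneg: "0 \<le> hausdorff_distance K L" for K L :: "'a set"
  proof (cases "K \<in> convex_bodies \<and> L \<in> convex_bodies")
    case True
    then show ?thesis using hausdorff_distance_less_iff[of K L 0] by force
  qed (auto simp: hausdorff_distance_def)
  show "hausdorff_distance K L = hausdorff_distance L K"
    by (simp add: hausdorff_distance_def conj_ac)
  {
    fix K L :: "'a set"
    assume KL: "K \<in> convex_bodies" "L \<in> convex_bodies" and z: "hausdorff_distance K L = 0"
    have "x \<in> L" if x: "x \<in> K" for x
    proof -
      have "\<exists>y\<in>L. dist y x < e" if "e > 0" for e
        using hausdorff_distance_less_iff[OF KL, of e] z that x
        by (metis dist_commute le_less_trans)
      then have "x \<in> closure L" by (simp add: closure_approachable)
      then show ?thesis using KL by (simp add: convex_bodies_def compact_imp_closed)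
    qed
    moreover have "x \<in> K" if x: "x \<in> L" for x
    proof -
      have "\<exists>y\<in>K. dist y x < e" if "e > 0" for e
        using hausdorff_distance_less_iff[OF KL, of e] z that x
        by (metis dist_commute le_less_trans)
      then have "x \<in> closure K" by (simp add: closure_approachable)
      then show ?thesis using KL by (simp add: convex_bodies_def compact_imp_closed)
    qed
    ultimately have "K = L" by blast
  }
  moreover have "hausdorff_distance K K = 0" if K: "K \<in> convex_bodies" for K :: "'a set"
  proof -
    have "hausdorff_distance K K < e" if "e > 0" for e
      unfolding hausdorff_distance_less_iff[OF K K]
      by (rule exI[of _ 0]) (use that in auto)
    from this[of "hausdorff_distance K K"] nonneg[of K K] show ?thesis by linarith
  qed
  ultimately show "(hausdorff_distance K L = 0) = (K = L)"
    if "K \<in> convex_bodies" "L \<in> convex_bodies"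
    using that by blast
  show "hausdorff_distance K N \<le> hausdorff_distance K L + hausdorff_distance L N"
    if K: "K \<in> convex_bodies" and L: "L \<in> convex_bodies" and N: "N \<in> convex_bodies"
  proof (rule field_le_epsilon)
    fix e :: real assume e: "e > 0"
    have "hausdorff_distance K L < hausdorff_distance K L + e/2" using e by simp
    then obtain a where a: "0 \<le> a" "a < hausdorff_distance K L + e/2"
      "\<And>x. x \<in> K \<Longrightarrow> \<exists>y\<in>L. dist x y \<le> a" "\<And>y. y \<in> L \<Longrightarrow> \<exists>x\<in>K. dist y x \<le> a"
      unfolding hausdorff_distance_less_iff[OF K L] by blast
    have "hausdorff_distance L N < hausdorff_distance L N + e/2" using e by simp
    then obtain b where b: "0 \<le> b" "b < hausdorff_distance L N + e/2"
      "\<And>x. x \<in> L \<Longrightarrow> \<exists>y\<in>N. dist x y \<le> b" "\<And>y. y \<in> N \<Longrightarrow> \<exists>x\<in>L. dist y x \<le> b"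
      unfolding hausdorff_distance_less_iff[OF L N] by blast
    have 1: "\<exists>y\<in>N. dist x y \<le> a + b" if "x \<in> K" for x
    proof -
      from a(3)[OF that] obtain y where y: "y \<in> L" "dist x y \<le> a" by blast
      from b(3)[OF y(1)] obtain z where z: "z \<in> N" "dist y z \<le> b" by blast
      have "dist x z \<le> a + b" using dist_triangle[of x z y] y z by linarith
      with z show ?thesis by blast
    qed
    have 2: "\<exists>x\<in>K. dist y x \<le> a + b" if "y \<in> N" for y
    proof -
      from b(4)[OF that] obtain z where z: "z \<in> L" "dist y z \<le> b" by blast
      from a(4)[OF z(1)] obtain x where x: "x \<in> K" "dist z x \<le> a" by blast
      have "dist y x \<le> a + b" using dist_triangle[of y x z] x z by linarith
      with x show ?thesis by blast
    qed
    have "hausdorff_distance K N < hausdorff_distance K L + hausdorff_distance L N + e"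
      unfolding hausdorff_distance_less_iff[OF K N]
    proof (intro exI[of _ "a + b"] conjI ballI)
      show "0 \<le> a + b" "a + b < hausdorff_distance K L + hausdorff_distance L N + e"
        using a(1,2) b(1,2) by linarith+
    qed (fact 1 2)+
    then show "hausdorff_distance K N \<le> hausdorff_distance K L + hausdorff_distance L N + e"
      by simp
  qed
qed

definition hausdorff_topology :: "'a::euclidean_space set topology" where
  "hausdorff_topology = Metric_space.mtopology convex_bodies hausdorff_distance"

text \<open>\<open>closure_of\<close> disregards points outside the space, so the inclusion has to be stated
  separately.\<close>

definition dense_subset_of :: "'b topology \<Rightarrow> 'b set \<Rightarrow> bool" where
  "dense_subset_of T S \<longleftrightarrow> S \<subseteq> topspace T \<and> T closure_of S = topspace T"

end

theory Submission
  imports Defs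
begin

text \<open>
  Why the theorem holds.  A convex body is, up to a small error, the intersection of finitely many
  half-spaces that support a slightly enlarged copy of it, and this remains true if the bounding
  hyperplanes are moved a little.  So around a point \<open>z\<close> there is an open pattern of hyperplanes,
  described in lemma \<open>prescribed_cell\<close>: each facet neighbourhood contains a hyperplane of the
  system, and no hyperplane outside these neighbourhoods meets a certain ball about \<open>z\<close>.  Whenever
  the pattern occurs, the cell containing \<open>z\<close> is close to a translate of the body.

  Full support of the directional distribution gives every facet neighbourhood positive measure, and
  the hyperplanes meeting a ball have finite measure.  Hence the void probabilities and the
  independence in the Poisson property give the pattern at \<open>z\<close> a positive probability.

  To obtain the pattern almost surely, it is tried at infinitely many centres on a line.  The trials
  are not independent, since one hyperplane can meet several of the balls.  However, a hyperplane
  that meets two balls of fixed radius with distant centres has its normal close to the great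
  subsphere orthogonal to the line, and great subspheres are null sets.  Sufficiently
  sparse centres therefore make the set \<open>W\<close> of all hyperplanes that meet at least two balls as small
  as desired (lemma \<open>sparse_centres\<close>).  Outside \<open>W\<close> the balls see disjoint sets of hyperplanes, the
  trials restricted to the complement of \<open>W\<close> are independent with success probabilities bounded
  below, and so one of them succeeds almost surely; and with probability close to one no hyperplane
  of the process lies in \<open>W\<close>.  This is lemma \<open>AE_pattern_somewhere\<close>.

  Density follows by applying this to the countably many convex hulls of finite subsets of a
  countable dense set of points.  Density also includes that all cells are convex bodies.  Cells
  are bounded because, for each of the \<open>2d\<close> signed coordinate directions, there are arbitrarily distant
  hyperplanes of the process with almost this direction (lemma \<open>AE_cells_convex_bodies\<close>).
\<close>

section \<open>Hyperplanes and convex cells\<close>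

lemma hyperplane_eq_iff:
  fixes u v :: "'a::euclidean_space"
  assumes u: "norm u = 1" and v: "norm v = 1"
  shows "hyperplane u s = hyperplane v t \<longleftrightarrow> (u = v \<and> s = t) \<or> (u = - v \<and> s = - t)"
proof
  assume eq: "hyperplane u s = hyperplane v t"
  have uu: "u \<bullet> u = 1" and vv: "v \<bullet> v = 1" using u v by (simp_all add: norm_eq_1)
  have *: "v \<bullet> x = t" if "u \<bullet> x = s" for x
    using eq that by (auto simp: hyperplane_def)
  define c where "c = v \<bullet> u"
  have t: "t = s * c" using *[of "s *\<^sub>R u"] by (simp add: uu c_def)
  \<comment> \<open>the component of \<open>v\<close> orthogonal to \<open>u\<close>; moving along it inside the hyperplane shows that it vanishes\<close>
  define w where "w = v - c *\<^sub>R u"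
  have uw: "u \<bullet> w = 0" by (simp add: w_def inner_diff_right uu c_def inner_commute)
  have "v \<bullet> (s *\<^sub>R u + w) = t" by (rule *) (simp add: inner_add_right uu uw)
  then have "v \<bullet> w = 0" by (simp add: inner_add_right t c_def)
  then have "w \<bullet> w = 0" using uw by (simp add: w_def inner_diff_left)
  then have v_eq: "v = c *\<^sub>R u" by (simp add: w_def)
  then have "\<bar>c\<bar> = 1" using u v by simp
  then have "c = 1 \<or> c = -1" by linarith
  then show "(u = v \<and> s = t) \<or> (u = - v \<and> s = - t)" using v_eq t by auto
next
  assume "(u = v \<and> s = t) \<or> (u = - v \<and> s = - t)"
  then show "hyperplane u s = hyperplane v t" by (auto simp: hyperplane_def)
qed

text \<open>Sets of hyperplanes are described by sets of pairs of a unit normal and an offset.  The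
  parametrization is two-to-one, so the parameter set of \<open>hyperplanes_of N\<close> is the symmetrization
  of \<open>N\<close>.\<close>

definition hyperplanes_of :: "('a::euclidean_space \<times> real) set \<Rightarrow> 'a set set" where
  "hyperplanes_of N = {hyperplane u t | u t. norm u = 1 \<and> (u, t) \<in> N}"

lemma hyperplanes_of_subset: "hyperplanes_of N \<subseteq> hyperplanes"
  by (auto simp: hyperplanes_of_def hyperplanes_def)

lemma hyperplane_in_hyperplanes_of_iff:
  fixes u :: "'a::euclidean_space"
  assumes "norm u = 1"
  shows "hyperplane u t \<in> hyperplanes_of N \<longleftrightarrow> (u, t) \<in> N \<or> (- u, - t) \<in> N"
proof
  assume "hyperplane u t \<in> hyperplanes_of N"
  then obtain v s where vs: "norm v = 1" "(v, s) \<in> N" "hyperplane u t = hyperplane v s"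
    by (auto simp: hyperplanes_of_def)
  then show "(u, t) \<in> N \<or> (- u, - t) \<in> N" using hyperplane_eq_iff[OF assms vs(1), of t s] by auto
next
  have eq: "hyperplane (- u) (- t) = hyperplane u t" by (auto simp: hyperplane_def)
  have "norm (- u) = 1" using assms by simp
  then have "hyperplane (- u) (- t) \<in> hyperplanes_of N" if "(- u, - t) \<in> N"
    unfolding hyperplanes_of_def using that by blast
  moreover have "hyperplane u t \<in> hyperplanes_of N" if "(u, t) \<in> N"
    unfolding hyperplanes_of_def using assms that by blast
  moreover assume "(u, t) \<in> N \<or> (- u, - t) \<in> N"
  ultimately show "hyperplane u t \<in> hyperplanes_of N"
    unfolding eq by blast
qed

lemma connected_one_side_of_hyperplane:
  fixes C :: "'a::euclidean_space set"
  assumes C: "connected C" "C \<inter> hyperplane u t = {}" and x: "x \<in> C" "u \<bullet> x < t" and y: "y \<in> C"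
  shows "u \<bullet> y < t"
proof (rule ccontr)
  assume "\<not> u \<bullet> y < t"
  then have "\<exists>z\<in>C. u \<bullet> z = t"
    using connected_ivt_hyperplane[OF C(1) x(1) y, of u t] x(2) by simp
  with C(2) show False by (auto simp: hyperplane_def)
qed

text \<open>A component lies on one side of each hyperplane.  So a segment between two of its points crosses
  no hyperplane, and a component contains every connected subset of the complement that it meets.\<close>

lemma convex_component_of_hyperplane_complement:
  fixes S :: "'a::euclidean_space set set"
  assumes S: "S \<subseteq> hyperplanes" and C: "C \<in> components (UNIV - \<Union>S)"
  shows "convex C"
  unfolding convex_contains_segment
proof (intro ballI)
  fix x y assume x: "x \<in> C" and y: "y \<in> C"
  have C_sub: "C \<subseteq> UNIV - \<Union>S" and conn: "connected C"
    using C in_components_subset in_components_connected by blast+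
  have "closed_segment x y \<subseteq> UNIV - \<Union>S"
  proof
    fix z assume z: "z \<in> closed_segment x y"
    show "z \<in> UNIV - \<Union>S"
    proof (clarsimp)
      fix H assume H: "H \<in> S" "z \<in> H"
      then obtain u t where ut: "H = hyperplane u t" using S by (auto simp: hyperplanes_def)
      have disj: "C \<inter> hyperplane u t = {}" using C_sub H(1) ut by blast
      have disj': "C \<inter> hyperplane (- u) (- t) = {}" using disj by (auto simp: hyperplane_def)
      have "u \<bullet> x \<noteq> t" using disj x by (auto simp: hyperplane_def)
      then consider "u \<bullet> x < t" | "(- u) \<bullet> x < - t" by force
      then show False
      proof cases
        case 1
        then have "{x, y} \<subseteq> {w. u \<bullet> w < t}"
          using connected_one_side_of_hyperplane[OF conn disj x _ y] by auto
        then have "closed_segment x y \<subseteq> {w. u \<bullet> w < t}"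
          unfolding segment_convex_hull by (intro hull_minimal convex_halfspace_lt)
        with z H(2) ut show False by (auto simp: hyperplane_def)
      next
        case 2
        then have "{x, y} \<subseteq> {w. (- u) \<bullet> w < - t}"
          using connected_one_side_of_hyperplane[OF conn disj' x _ y] by auto
        then have "closed_segment x y \<subseteq> {w. (- u) \<bullet> w < - t}"
          unfolding segment_convex_hull by (intro hull_minimal convex_halfspace_lt)
        with z H(2) ut show False by (auto simp: hyperplane_def)
      qed
    qed
  qed
  then show "closed_segment x y \<subseteq> C"
    using x by (intro components_maximal[OF C]) auto
qed

section \<open>Bounded cells\<close>

text \<open>Hyperplanes that an escape to infinity in direction \<open>e\<close> has to cross, beyond distance \<open>r\<close>.  The
  tolerance is so small that the \<open>2d\<close> half-spaces for the signed basis vectors still have a bounded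
  intersection.\<close>

definition exits :: "'a::euclidean_space \<Rightarrow> real \<Rightarrow> ('a \<times> real) set" where
  "exits e r = {(u, t). dist u e < 1 / (2 * DIM('a)) \<and> r < t}"

text \<open>Replacing \<open>e\<close> by a normal at distance less than \<open>1/(2d)\<close> costs at most \<open>norm x / (2d)\<close> in each
  coordinate of \<open>x\<close>.  Summed over the \<open>d\<close> coordinates, this is half of \<open>norm x\<close>, which can be
  absorbed into the left-hand side.\<close>

lemma bounded_of_almost_coordinate_bounds:
  fixes C :: "'a::euclidean_space set"
  assumes "\<And>e. e \<in> Basis \<union> uminus ` Basis \<Longrightarrow>
    \<exists>u t. dist u e < 1 / (2 * DIM('a)) \<and> (\<forall>x\<in>C. u \<bullet> x < t)"
  shows "bounded C"
proof -
  define d where "d = real DIM('a)"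
  have d: "d > 0" by (simp add: d_def)
  let ?E = "Basis \<union> uminus ` (Basis :: 'a set)"
  have "\<forall>e\<in>?E. \<exists>p. dist (fst p) e < 1 / (2 * d) \<and> (\<forall>x\<in>C. fst p \<bullet> x < (snd p :: real))"
    using assms by (simp add: d_def)
  then obtain p where p: "\<And>e. e \<in> ?E \<Longrightarrow> dist (fst (p e)) e < 1 / (2 * d) \<and> (\<forall>x\<in>C. fst (p e) \<bullet> x < snd (p e))"
    using bchoice[of ?E "\<lambda>e p. dist (fst p) e < 1 / (2 * d) \<and> (\<forall>x\<in>C. fst p \<bullet> x < (snd p :: real))"]
    by blast
  define u t where "u e = fst (p e)" and "t e = snd (p e)" for e
  have ut: "dist (u e) e < 1 / (2 * d)" "x \<in> C \<Longrightarrow> u e \<bullet> x < t e" if "e \<in> ?E" for e x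
    using p[OF that] by (auto simp: u_def t_def)
  define T where "T = Max (t ` ?E)"
  have T: "t e \<le> T" if "e \<in> ?E" for e using that by (auto simp: T_def)
  have le: "e \<bullet> x \<le> T + norm x / (2 * d)" if e: "e \<in> ?E" and x: "x \<in> C" for e x
  proof -
    have "(e - u e) \<bullet> x \<le> norm (e - u e) * norm x" by (rule norm_cauchy_schwarz)
    also have "\<dots> \<le> 1 / (2 * d) * norm x"
      using ut(1)[OF e] by (intro mult_right_mono) (auto simp: dist_norm norm_minus_commute)
    finally show ?thesis using ut(2)[OF e x] T[OF e] by (simp add: inner_diff_left)
  qed
  have "norm x \<le> 2 * d * T" if x: "x \<in> C" for x
  proof -
    have "norm x \<le> (\<Sum>b\<in>Basis. \<bar>x \<bullet> b\<bar>)" by (rule norm_le_l1)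
    also have "\<dots> \<le> (\<Sum>b\<in>(Basis::'a set). T + norm x / (2 * d))"
    proof (rule sum_mono)
      fix b :: 'a assume b: "b \<in> Basis"
      show "\<bar>x \<bullet> b\<bar> \<le> T + norm x / (2 * d)"
        using le[of b x] le[of "- b" x] b x by (auto simp: inner_commute)
    qed
    also have "\<dots> = d * T + norm x / 2" using d by (simp add: d_def[symmetric] field_simps)
    finally show ?thesis by simp
  qed
  then show ?thesis unfolding bounded_iff by blast
qed

lemma cells_in_convex_bodies:
  fixes S :: "'a::euclidean_space set set"
  assumes S: "S \<subseteq> hyperplanes"
    and hit: "\<And>(n::nat) e. e \<in> Basis \<union> uminus ` Basis \<Longrightarrow> S \<inter> hyperplanes_of (exits e n) \<noteq> {}"
  shows "cells S \<subseteq> convex_bodies"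
proof
  fix K assume "K \<in> cells S"
  then obtain C where C: "C \<in> components (UNIV - \<Union>S)" and K: "K = closure C"
    by (auto simp: cells_def)
  have C_sub: "C \<subseteq> UNIV - \<Union>S" and conn: "connected C" and ne: "C \<noteq> {}"
    using C in_components_subset in_components_connected in_components_nonempty by blast+
  obtain p where p: "p \<in> C" using ne by blast
  obtain n :: nat where n: "norm p < n" using reals_Archimedean2 by blast
  have "bounded C"
  proof (rule bounded_of_almost_coordinate_bounds)
    fix e :: 'a assume "e \<in> Basis \<union> uminus ` Basis"
    from hit[OF this, of n] obtain u and t :: real where
      ut: "hyperplane u t \<in> S" "norm u = 1" "dist u e < 1 / (2 * DIM('a))" "n < t"
      by (auto simp: hyperplanes_of_def exits_def)
    have disj: "C \<inter> hyperplane u t = {}" using C_sub ut(1) by blast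
    have "u \<bullet> p < t" using norm_cauchy_schwarz[of u p] ut n by simp
    then have "\<forall>x\<in>C. u \<bullet> x < t"
      using connected_one_side_of_hyperplane[OF conn disj p] by blast
    with ut(3) show "\<exists>u t. dist u e < 1 / (2 * DIM('a)) \<and> (\<forall>x\<in>C. u \<bullet> x < t)" by blast
  qed
  moreover have "convex C" by (rule convex_component_of_hyperplane_complement[OF S C])
  ultimately show "K \<in> convex_bodies"
    using ne by (simp add: K convex_bodies_def convex_closure)
qed

section \<open>Prescribing a cell\<close>

text \<open>Parameters of a hyperplane close to the one with normal \<open>u\<close> at signed distance \<open>h\<close> from the
  point \<open>z\<close>; the offset from the origin is larger by \<open>v \<bullet> z\<close>.\<close>

definition facet_params :: "'a::euclidean_space \<Rightarrow> real \<Rightarrow> real \<Rightarrow> 'a \<Rightarrow> ('a \<times> real) set" where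
  "facet_params u h \<eta> z = {(v, t). dist v u < \<eta> \<and> \<bar>t - v \<bullet> z - h\<bar> < \<eta>}"

definition ball_params :: "'a::euclidean_space \<Rightarrow> real \<Rightarrow> ('a \<times> real) set" where
  "ball_params z R = {(v, t). \<bar>t - v \<bullet> z\<bar> < R}"

lemma hyperplane_meets_ball:
  fixes z :: "'a::euclidean_space"
  assumes "H \<in> hyperplanes" "x \<in> H" "dist z x < R"
  shows "H \<in> hyperplanes_of (ball_params z R)"
proof -
  obtain v t where vt: "norm v = 1" "H = hyperplane v t" using assms(1) by (auto simp: hyperplanes_def)
  have "\<bar>v \<bullet> (x - z)\<bar> \<le> norm v * norm (x - z)" by (rule Cauchy_Schwarz_ineq2)
  then have "\<bar>t - v \<bullet> z\<bar> < R"
    using assms vt by (simp add: hyperplane_def inner_diff_right dist_norm norm_minus_commute)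
  then show ?thesis using vt by (auto simp: hyperplanes_of_def ball_params_def)
qed

lemma facet_hyperplanes_subset_ball:
  assumes "\<eta> < h" "h + \<eta> \<le> R"
  shows "hyperplanes_of (facet_params u h \<eta> z) \<subseteq> hyperplanes_of (ball_params z R)"
proof -
  have "facet_params u h \<eta> z \<subseteq> ball_params z R"
    using assms by (auto simp: facet_params_def ball_params_def)
  then show ?thesis unfolding hyperplanes_of_def by blast
qed

text \<open>Both parameters of a common hyperplane would agree up to sign.  Equal signs are excluded by the
  separation of the normals, opposite signs because both signed distances from \<open>z\<close> are positive.\<close>

lemma facet_hyperplanes_disjoint:
  fixes u u' :: "'a::euclidean_space"
  assumes h: "\<eta> < h" "\<eta> < h'" and uu': "2 * \<eta> \<le> dist u u'"
  shows "hyperplanes_of (facet_params u h \<eta> z) \<inter> hyperplanes_of (facet_params u' h' \<eta> z) = {}"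
proof -
  have False if v: "norm v = 1" "(v, t) \<in> facet_params u h \<eta> z"
    and H: "hyperplane v t \<in> hyperplanes_of (facet_params u' h' \<eta> z)" for v t
  proof -
    have 1: "dist v u < \<eta>" "\<bar>t - v \<bullet> z - h\<bar> < \<eta>" using v by (auto simp: facet_params_def)
    from H v(1) have "(v, t) \<in> facet_params u' h' \<eta> z \<or> (- v, - t) \<in> facet_params u' h' \<eta> z"
      by (simp add: hyperplane_in_hyperplanes_of_iff)
    then have "dist v u' < \<eta> \<or> \<bar>- t + v \<bullet> z - h'\<bar> < \<eta>"
      by (auto simp: facet_params_def)
    then show False
    proof
      assume "dist v u' < \<eta>"
      with 1 uu' dist_triangle[of u u' v] show False by (simp add: dist_commute)
    next
      assume "\<bar>- t + v \<bullet> z - h'\<bar> < \<eta>"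
      with 1 h show False by linarith
    qed
  qed
  then show ?thesis by (fastforce simp: hyperplanes_of_def)
qed

lemma finite_separated_net_sphere:
  fixes \<delta> :: real
  assumes "\<delta> > 0"
  obtains U :: "'a::euclidean_space set" and s where
    "finite U" "U \<subseteq> sphere 0 1" "\<And>w. norm w = 1 \<Longrightarrow> \<exists>u\<in>U. dist w u < \<delta>"
    "s > 0" "\<And>u u'. u \<in> U \<Longrightarrow> u' \<in> U \<Longrightarrow> u \<noteq> u' \<Longrightarrow> s \<le> dist u u'"
proof -
  have "compact (sphere (0::'a) 1)" by simp
  then obtain U :: "'a set" where U: "finite U" "U \<subseteq> sphere 0 1" "sphere 0 1 \<subseteq> (\<Union>x\<in>U. ball x \<delta>)"
    using compactE_image[of "sphere (0::'a) 1" "sphere 0 1" "\<lambda>x. ball x \<delta>"] assms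
    by (metis UN_I centre_in_ball open_ball subsetI)
  define D where "D = {dist u u' | u u'. u \<in> U \<and> u' \<in> U \<and> u \<noteq> u'}"
  have "D \<subseteq> (\<lambda>(u, u'). dist u u') ` (U \<times> U)" by (auto simp: D_def)
  then have fin: "finite D" using U(1) finite_subset by blast
  define s where "s = Min (insert 1 D)"
  have "s > 0" using fin by (auto simp: s_def D_def)
  moreover have "s \<le> dist u u'" if "u \<in> U" "u' \<in> U" "u \<noteq> u'" for u u'
    unfolding s_def using fin that by (intro Min_le) (auto simp: D_def)
  moreover have "\<exists>u\<in>U. dist w u < \<delta>" if "norm w = 1" for w
  proof -
    have "w \<in> sphere 0 1" using that by simp
    with U(3) obtain u where "u \<in> U" "w \<in> ball u \<delta>" by blast
    then show ?thesis by (auto simp: dist_commute)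
  qed
  ultimately show ?thesis using U(1,2) by (intro that[of U s]) auto
qed

text \<open>A finite net \<open>U\<close> of directions and the support function of \<open>K\<close>, enlarged by \<open>e / 4\<close>, describe a
  polytope that is close to \<open>K\<close>, stably under perturbations of size \<open>\<eta>\<close>.  The enlargement keeps
  \<open>K\<close> strictly inside all perturbed half-spaces.  Conversely, a point of the perturbed polytope
  far from \<open>K\<close> would violate the half-space whose normal is nearest to the direction from its
  closest point in \<open>K\<close>.

  The separation of the directions and the bounds on \<open>h\<close> make the facet neighbourhoods disjoint
  subsets of the set of hyperplanes that meet the ball, as is needed for independence.\<close>

lemma prescribed_cell:
  fixes K :: "'a::euclidean_space set" and e :: real
  assumes K: "K \<in> convex_bodies" and K0: "0 \<in> K" and e: "e > 0"
  obtains U :: "'a set" and \<eta> R :: real and h where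
    "finite U" "U \<subseteq> sphere 0 1" "\<eta> > 0" "R \<ge> 0"
    "\<And>u. u \<in> U \<Longrightarrow> \<eta> < h u \<and> h u + \<eta> \<le> R"
    "\<And>u u'. u \<in> U \<Longrightarrow> u' \<in> U \<Longrightarrow> u \<noteq> u' \<Longrightarrow> 2 * \<eta> \<le> dist u u'"
    "\<And>S z. S \<subseteq> hyperplanes \<Longrightarrow>
       \<forall>u\<in>U. S \<inter> hyperplanes_of (facet_params u (h u) \<eta> z) \<noteq> {} \<Longrightarrow>
       S \<inter> hyperplanes_of (ball_params z R) \<subseteq> (\<Union>u\<in>U. hyperplanes_of (facet_params u (h u) \<eta> z)) \<Longrightarrow>
       \<exists>C\<in>cells S. (+) z ` K \<subseteq> C \<and> (\<forall>x\<in>C. \<exists>y\<in>K. dist x (z + y) \<le> e)"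
proof -
  define \<epsilon> where "\<epsilon> = e / 4"
  have \<epsilon>: "\<epsilon> > 0" and e_eq: "e = 4 * \<epsilon>" using e by (simp_all add: \<epsilon>_def)
  have cK: "compact K" "convex K" "closed K" "K \<noteq> {}"
    using K by (auto simp: convex_bodies_def compact_imp_closed)
  obtain r where r: "r > 0" "\<And>x. x \<in> K \<Longrightarrow> norm x \<le> r"
    using compact_imp_bounded[OF cK(1)] unfolding bounded_pos by blast
  \<comment> \<open>\<open>r + 1\<close> bounds the size of \<open>K\<close>, so that a change of direction by \<open>\<delta>\<close> moves offsets by at most \<open>\<epsilon> / 4\<close>\<close>
  define \<delta> where "\<delta> = min (1/4) (\<epsilon> / (4 * (r + 1)))"
  have \<delta>: "\<delta> > 0" "\<delta> \<le> 1/4" and \<delta>r: "\<delta> * (r + 1) \<le> \<epsilon> / 4"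
  proof -
    show "\<delta> > 0" using \<epsilon> r by (simp add: \<delta>_def)
    show "\<delta> \<le> 1/4" unfolding \<delta>_def by (rule min.cobounded1)
    have "\<delta> * (r + 1) \<le> \<epsilon> / (4 * (r + 1)) * (r + 1)"
      using r by (intro mult_right_mono) (auto simp: \<delta>_def)
    also have "\<dots> = \<epsilon> / 4" using r by (simp add: divide_simps)
    finally show "\<delta> * (r + 1) \<le> \<epsilon> / 4" .
  qed
  obtain U :: "'a set" and s where U: "finite U" "U \<subseteq> sphere 0 1"
    "\<And>w. norm w = 1 \<Longrightarrow> \<exists>u\<in>U. dist w u < \<delta>"
    "s > 0" "\<And>u u'. u \<in> U \<Longrightarrow> u' \<in> U \<Longrightarrow> u \<noteq> u' \<Longrightarrow> s \<le> dist u u'"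
    using finite_separated_net_sphere[OF \<delta>(1)] by metis
  define \<eta> where "\<eta> = min \<delta> (s / 2)"
  have \<eta>: "\<eta> > 0" "\<eta> \<le> \<delta>" "2 * \<eta> \<le> s" using \<delta> U(4) by (auto simp: \<eta>_def)
  have \<eta>r: "\<eta> * (r + 1) \<le> \<epsilon> / 4"
    by (rule order_trans[OF mult_right_mono[OF \<eta>(2)] \<delta>r]) (use r in simp)
  have "\<exists>y\<in>K. \<forall>x\<in>K. u \<bullet> x \<le> u \<bullet> y" for u
    by (rule continuous_attains_sup[OF cK(1,4)]) (intro continuous_intros)
  \<comment> \<open>\<open>m u\<close> is a point of \<open>K\<close> in the supporting hyperplane with outer normal \<open>u\<close>\<close>
  then obtain m where m: "\<And>u. m u \<in> K" "\<And>u x. x \<in> K \<Longrightarrow> u \<bullet> x \<le> u \<bullet> m u" by metis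
  define h where "h u = u \<bullet> m u + \<epsilon>" for u
  define R where "R = r + 2 * \<epsilon>"
  have abs_le: "\<bar>w \<bullet> x\<bar> \<le> a * b" if "norm w \<le> a" "norm x \<le> b" for w x :: 'a and a b
    using Cauchy_Schwarz_ineq2[of w x] mult_mono[OF that] norm_ge_zero[of w] norm_ge_zero[of x] that
    by linarith
  have \<eta>\<epsilon>: "\<eta> \<le> \<epsilon> / 4" using \<eta>r \<eta>(1) r(1) by (smt (verit) mult_le_cancel_left1)
  have K_lt: "v \<bullet> x < t" if x: "x \<in> K" and v: "dist v u < \<eta>" "\<bar>t - h u\<bar> < \<eta>" for v t u x
  proof -
    have "\<bar>(v - u) \<bullet> x\<bar> \<le> \<eta> * r" using v r(2)[OF x] by (intro abs_le) (auto simp: dist_norm)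
    then have "v \<bullet> x \<le> u \<bullet> x + \<eta> * r" by (simp add: inner_diff_left)
    also have "\<dots> \<le> h u - \<epsilon> + \<eta> * r" using m(2)[OF x, of u] by (simp add: h_def)
    also have "\<dots> < h u - \<eta>" using \<eta>r \<epsilon> by (simp add: algebra_simps)
    also have "\<dots> < t" using v(2) by simp
    finally show ?thesis .
  qed
  have close: "\<exists>y\<in>K. dist x y \<le> 4 * \<epsilon>"
    if x: "\<And>u. u \<in> U \<Longrightarrow> \<exists>v t. dist v u < \<eta> \<and> \<bar>t - h u\<bar> < \<eta> \<and> v \<bullet> x \<le> t" for x
  proof -
    define y where "y = closest_point K x"
    have y: "y \<in> K" unfolding y_def by (rule closest_point_in_set[OF cK(3,4)])
    define \<rho> where "\<rho> = dist x y"
    have "\<rho> \<le> 4 * \<epsilon>"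
    proof (cases "\<rho> = 0")
      case False
      then have \<rho>: "\<rho> > 0" by (simp add: \<rho>_def)
      define w where "w = (x - y) /\<^sub>R \<rho>"
      have xy: "x = y + \<rho> *\<^sub>R w" using \<rho> by (simp add: w_def)
      have w: "norm w = 1" using \<rho> by (simp add: w_def \<rho>_def dist_norm)
      then have ww: "w \<bullet> w = 1" by (simp add: norm_eq_1)
      have wK: "w \<bullet> q \<le> w \<bullet> y" if "q \<in> K" for q
      proof -
        have "(x - y) \<bullet> (q - y) \<le> 0"
          unfolding y_def by (rule closest_point_dot[OF cK(2,3) that])
        then have "w \<bullet> (q - y) \<le> 0" using \<rho> by (simp add: w_def mult_nonneg_nonpos)
        then show ?thesis by (simp add: inner_diff_right)
      qed
      obtain u where u: "u \<in> U" "dist w u < \<delta>" using U(3)[OF w] by blast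
      obtain v t where v: "dist v u < \<eta>" "\<bar>t - h u\<bar> < \<eta>" "v \<bullet> x \<le> t" using x[OF u(1)] by blast
      have nx: "norm x \<le> r + \<rho>"
        using norm_triangle_ineq[of y "\<rho> *\<^sub>R w"] r(2)[OF y] \<rho> w xy by simp
      have "dist w v < \<delta> + \<eta>" using dist_triangle[of w v u] u v by (simp add: dist_commute)
      then have 1: "\<bar>(w - v) \<bullet> x\<bar> \<le> (\<delta> + \<eta>) * (r + \<rho>)"
        using nx by (intro abs_le) (auto simp: dist_norm)
      have 2: "\<bar>(w - u) \<bullet> m u\<bar> \<le> \<delta> * r"
        using u r(2)[OF m(1)] by (intro abs_le) (auto simp: dist_norm)
      have "w \<bullet> y + \<rho> = w \<bullet> x" by (simp add: xy inner_add_right ww)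
      also have "\<dots> \<le> v \<bullet> x + (\<delta> + \<eta>) * (r + \<rho>)" using 1 by (simp add: inner_diff_left)
      also have "v \<bullet> x \<le> u \<bullet> m u + \<epsilon> + \<eta>" using v by (simp add: h_def)
      also have "u \<bullet> m u \<le> w \<bullet> m u + \<delta> * r" using 2 by (simp add: inner_diff_left)
      also have "w \<bullet> m u \<le> w \<bullet> y" by (rule wK[OF m(1)])
      finally have "\<rho> \<le> \<delta> * r + \<epsilon> + \<eta> + (\<delta> + \<eta>) * (r + \<rho>)" by simp
      also have "\<dots> = \<epsilon> + (\<delta> * r + \<delta> * r + \<eta> * (r + 1)) + (\<delta> + \<eta>) * \<rho>" by (simp add: algebra_simps)
      also have "\<delta> * r + \<delta> * r + \<eta> * (r + 1) \<le> \<epsilon>"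
        using \<delta>r \<eta>r \<delta> \<epsilon> by (simp add: algebra_simps)
      \<comment> \<open>\<open>x\<close> is not known to be bounded, but \<open>norm x \<le> r + \<rho>\<close>, and half of \<open>\<rho>\<close> can be absorbed\<close>
      also have "(\<delta> + \<eta>) * \<rho> \<le> 1/2 * \<rho>" using \<delta> \<eta> \<rho> by (intro mult_right_mono) auto
      finally show ?thesis by simp
    qed (use \<epsilon> in simp)
    with y show ?thesis by (auto simp: \<rho>_def)
  qed
  show ?thesis
  proof (rule that[of U \<eta> R h])
    show "finite U" "U \<subseteq> sphere 0 1" "\<eta> > 0" by fact+
    show "R \<ge> 0" using r(1) \<epsilon> by (simp add: R_def)
    show "2 * \<eta> \<le> dist u u'" if "u \<in> U" "u' \<in> U" "u \<noteq> u'" for u u'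
      using U(5)[OF that] \<eta> by simp
    show "\<eta> < h u \<and> h u + \<eta> \<le> R" if u: "u \<in> U" for u
    proof -
      have "0 \<le> u \<bullet> m u" using m(2)[OF K0, of u] by simp
      moreover have "u \<bullet> m u \<le> 1 * r" using abs_le[of u 1 "m u" r] u U(2) r(2)[OF m(1)] by auto
      ultimately show ?thesis using \<eta>\<epsilon> \<epsilon> by (simp add: h_def R_def)
    qed
  next
    fix S z assume S: "S \<subseteq> hyperplanes"
      and hit: "\<forall>u\<in>U. S \<inter> hyperplanes_of (facet_params u (h u) \<eta> z) \<noteq> {}"
      and only: "S \<inter> hyperplanes_of (ball_params z R)
        \<subseteq> (\<Union>u\<in>U. hyperplanes_of (facet_params u (h u) \<eta> z))"
    have avoid: "(+) z ` K \<subseteq> UNIV - \<Union>S"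
    proof (clarsimp)
      fix x H assume x: "x \<in> K" and H: "H \<in> S" "z + x \<in> H"
      have "dist z (z + x) < R" using r(2)[OF x] \<epsilon> by (simp add: R_def dist_norm)
      then have "H \<in> hyperplanes_of (ball_params z R)"
        using H S by (intro hyperplane_meets_ball[of H "z + x"]) auto
      with only H(1) obtain u where "H \<in> hyperplanes_of (facet_params u (h u) \<eta> z)" by blast
      then obtain v t where
        v: "H = hyperplane v t" "dist v u < \<eta>" "\<bar>t - v \<bullet> z - h u\<bar> < \<eta>"
        by (auto simp: hyperplanes_of_def facet_params_def)
      from K_lt[OF x v(2,3)] H(2) v(1) show False by (simp add: hyperplane_def inner_add_right)
    qed
    have z: "z \<in> (+) z ` K" using K0 by force
    then have "z \<in> UNIV - \<Union>S" using avoid by blast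
    then obtain C where C: "C \<in> components (UNIV - \<Union>S)" "z \<in> C"
      by (metis Union_components UnionE)
    have C_sub: "C \<subseteq> UNIV - \<Union>S" and conn: "connected C"
      using C in_components_subset in_components_connected by blast+
    have "connected ((+) z ` K)" using cK(2) by (simp add: convex_connected)
    then have KC: "(+) z ` K \<subseteq> C"
      using C z avoid by (intro components_maximal[OF C(1)]) auto
    have "\<exists>y\<in>K. dist x (z + y) \<le> 4 * \<epsilon>" if x: "x \<in> closure C" for x
    proof -
      have "\<exists>v t. dist v u < \<eta> \<and> \<bar>t - h u\<bar> < \<eta> \<and> v \<bullet> (x - z) \<le> t" if u: "u \<in> U" for u
      proof -
        obtain H where H: "H \<in> S" "H \<in> hyperplanes_of (facet_params u (h u) \<eta> z)"
          using hit u by blast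
        then obtain v t where
          v: "hyperplane v t \<in> S" "dist v u < \<eta>" "\<bar>t - v \<bullet> z - h u\<bar> < \<eta>"
          by (auto simp: hyperplanes_of_def facet_params_def)
        have side: "v \<bullet> z < t" using K_lt[OF K0 v(2,3)] by simp
        have "C \<inter> hyperplane v t = {}" using C_sub v(1) by blast
        then have "C \<subseteq> {y. v \<bullet> y \<le> t}"
          using connected_one_side_of_hyperplane[OF conn _ C(2) side] by (auto intro: less_imp_le)
        then have "closure C \<subseteq> {y. v \<bullet> y \<le> t}"
          by (intro closure_minimal closed_halfspace_le)
        then have "v \<bullet> (x - z) \<le> t - v \<bullet> z" using x by (auto simp: inner_diff_right)
        with v show ?thesis by blast
      qed
      from close[of "x - z", OF this] obtain y where "y \<in> K" "dist (x - z) y \<le> 4 * \<epsilon>" by blast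
      then show ?thesis by (intro bexI[of _ y]) (simp_all add: dist_norm algebra_simps)
    qed
    moreover have "closure C \<in> cells S" using C by (auto simp: cells_def)
    moreover have "(+) z ` K \<subseteq> closure C" using KC closure_subset by blast
    ultimately show "\<exists>C\<in>cells S. (+) z ` K \<subseteq> C \<and> (\<forall>x\<in>C. \<exists>y\<in>K. dist x (z + y) \<le> e)"
      unfolding e_eq by blast
  qed
qed

section \<open>Hyperplane sets determined by parameters\<close>

lemma sets_hyperplane_borel: "sets hyperplane_borel = sigma_sets hyperplanes {U. openin hyperplane_topology U}"
  unfolding hyperplane_borel_def using openin_subset[of hyperplane_topology]
  by (intro sets_measure_of) auto

lemma space_hyperplane_borel: "space hyperplane_borel = hyperplanes"
  unfolding hyperplane_borel_def by (rule space_measure_of_conv)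

text \<open>The topology is the quotient topology, and the preimage of \<open>hyperplanes_of N\<close> is the
  symmetrization of \<open>N\<close>, which is open.\<close>

lemma hyperplanes_of_measurable:
  fixes N :: "('a::euclidean_space \<times> real) set"
  assumes "open N"
  shows "hyperplanes_of N \<in> sets hyperplane_borel"
proof -
  let ?S = "sphere (0::'a) 1 \<times> (UNIV::real set)"
  have "{p \<in> ?S. hyperplane (fst p) (snd p) \<in> hyperplanes_of N} = ?S \<inter> (N \<union> uminus ` N)"
  proof (intro set_eqI)
    fix p :: "'a \<times> real"
    have "p \<in> uminus ` N \<longleftrightarrow> - p \<in> N" by (metis image_iff minus_minus)
    then show "p \<in> {p \<in> ?S. hyperplane (fst p) (snd p) \<in> hyperplanes_of N} \<longleftrightarrow> p \<in> ?S \<inter> (N \<union> uminus ` N)"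
      by (cases p) (auto simp: hyperplane_in_hyperplanes_of_iff)
  qed
  moreover have "openin (top_of_set ?S) (?S \<inter> (N \<union> uminus ` N))"
    using assms by (intro openin_open_Int open_Un open_negations)
  ultimately have "openin hyperplane_topology (hyperplanes_of N)"
    unfolding openin_hyperplane_topology by (intro conjI hyperplanes_of_subset) (simp only:)
  then show ?thesis unfolding sets_hyperplane_borel by (intro sigma_sets.Basic) simp
qed

lemma open_exits: "open (exits e r)"
  unfolding exits_def case_prod_unfold by (intro open_Collect_conj open_Collect_less continuous_intros)

lemma open_facet_params: "open (facet_params u h \<eta> z)"
  unfolding facet_params_def case_prod_unfold
  by (intro open_Collect_conj open_Collect_less continuous_intros)

lemma open_ball_params: "open (ball_params z R)"
  unfolding ball_params_def case_prod_unfold by (intro open_Collect_less continuous_intros)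

lemmas hyperplanes_of_params_measurable [measurable, simp] =
  hyperplanes_of_measurable[OF open_facet_params] hyperplanes_of_measurable[OF open_ball_params]

lemma measurable_hyperplane_map:
  fixes \<phi> :: "'a::euclidean_space measure"
  assumes "sets \<phi> = sets (restrict_space borel (sphere 0 1))"
  shows "(\<lambda>p. hyperplane (fst p) (snd p)) \<in> measurable (\<phi> \<Otimes>\<^sub>M lborel) hyperplane_borel"
  unfolding hyperplane_borel_def
proof (rule measurable_measure_of)
  have space: "space (\<phi> \<Otimes>\<^sub>M (lborel :: real measure)) = sphere 0 1 \<times> UNIV"
    using sets_eq_imp_space_eq[OF assms] by (simp add: space_pair_measure)
  show "{U. openin hyperplane_topology U} \<subseteq> Pow (hyperplanes :: 'a set set)"
    using openin_subset[of hyperplane_topology] by auto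
  show "(\<lambda>p. hyperplane (fst p) (snd p)) \<in> space (\<phi> \<Otimes>\<^sub>M lborel) \<rightarrow> hyperplanes"
    unfolding space by (auto simp: hyperplanes_def)
  fix U :: "'a set set" assume "U \<in> {U. openin hyperplane_topology U}"
  then have "openin (top_of_set (sphere 0 1 \<times> UNIV))
      {p \<in> sphere 0 1 \<times> UNIV. hyperplane (fst p) (snd p) \<in> U}"
    unfolding openin_hyperplane_topology by blast
  then obtain T where T: "open T"
    "{p \<in> sphere (0::'a) 1 \<times> UNIV. hyperplane (fst p) (snd p) \<in> U} = sphere 0 1 \<times> UNIV \<inter> T"
    unfolding openin_open by blast
  have "(\<lambda>x. x) \<in> measurable \<phi> borel"
    using assms by (subst measurable_cong_sets[OF assms refl]) (intro measurable_restrict_space1, simp)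
  then have "(\<lambda>p. (fst p, snd p)) \<in> measurable (\<phi> \<Otimes>\<^sub>M lborel) (borel \<Otimes>\<^sub>M (borel :: real measure))"
    by (intro measurable_Pair measurable_compose[OF measurable_fst] measurable_compose[OF measurable_snd]) auto
  then have "(\<lambda>p. p) \<in> measurable (\<phi> \<Otimes>\<^sub>M (lborel :: real measure)) borel"
    by (simp add: borel_prod)
  from measurable_sets[OF this, of T] T(1)
  have "T \<inter> space (\<phi> \<Otimes>\<^sub>M lborel) \<in> sets (\<phi> \<Otimes>\<^sub>M lborel)" by simp
  moreover have "(\<lambda>p. hyperplane (fst p) (snd p)) -` U \<inter> space (\<phi> \<Otimes>\<^sub>M lborel) = T \<inter> space (\<phi> \<Otimes>\<^sub>M lborel)"
    unfolding space using T(2) by blast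
  ultimately show "(\<lambda>p. hyperplane (fst p) (snd p)) -` U \<inter> space (\<phi> \<Otimes>\<^sub>M lborel) \<in> sets (\<phi> \<Otimes>\<^sub>M lborel)"
    by simp
qed

section \<open>The measure of hyperplanes in a pattern\<close>

text \<open>For a process with directional distribution \<open>\<phi>\<close> and intensity \<open>\<gamma>\<close>, the intensity measure divided
  by \<open>\<gamma>\<close>.\<close>

definition hyperplane_measure :: "'a::euclidean_space measure \<Rightarrow> 'a set measure" where
  "hyperplane_measure \<phi> =
     distr (\<phi> \<Otimes>\<^sub>M lborel) hyperplane_borel (\<lambda>p. hyperplane (fst p) (snd p))"

locale directional_distribution = prob_space \<phi> for \<phi> :: "'a::euclidean_space measure" +
  assumes sets_\<phi>: "sets \<phi> = sets (restrict_space borel (sphere 0 1))"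
    and support_\<phi>: "measure_support \<phi> = sphere 0 1"
    and great_subsphere_null: "norm u = 1 \<Longrightarrow> emeasure \<phi> ({x. u \<bullet> x = 0} \<inter> sphere 0 1) = 0"
begin

abbreviation \<Lambda> :: "'a set measure" where "\<Lambda> \<equiv> hyperplane_measure \<phi>"

lemma space_\<phi>: "space \<phi> = sphere 0 1"
  using sets_eq_imp_space_eq[OF sets_\<phi>] by simp

lemma Int_sphere_measurable: "B \<in> sets borel \<Longrightarrow> B \<inter> sphere 0 1 \<in> sets \<phi>"
  by (auto simp: sets_\<phi> sets_restrict_space Int_commute)

lemma sets_\<Lambda> [measurable_cong, simp]: "sets \<Lambda> = sets hyperplane_borel"
  by (simp add: hyperplane_measure_def)

lemma emeasure_\<Lambda>_eq_integral:
  assumes A: "A \<in> sets hyperplane_borel"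
  shows "emeasure \<Lambda> A = (\<integral>\<^sup>+u. (\<integral>\<^sup>+t. indicator A (hyperplane u t) \<partial>lborel) \<partial>\<phi>)"
proof -
  let ?g = "\<lambda>p :: 'a \<times> real. hyperplane (fst p) (snd p)"
  note m = measurable_hyperplane_map[OF sets_\<phi>]
  have "emeasure \<Lambda> A = emeasure (\<phi> \<Otimes>\<^sub>M lborel) (?g -` A \<inter> space (\<phi> \<Otimes>\<^sub>M lborel))"
    unfolding hyperplane_measure_def by (rule emeasure_distr[OF m A])
  also have "\<dots> = (\<integral>\<^sup>+u. (\<integral>\<^sup>+t. indicator (?g -` A \<inter> space (\<phi> \<Otimes>\<^sub>M lborel)) (u, t) \<partial>lborel) \<partial>\<phi>)"
    by (rule lborel.emeasure_pair_measure[OF measurable_sets[OF m A]])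
  also have "\<dots> = (\<integral>\<^sup>+u. (\<integral>\<^sup>+t. indicator A (hyperplane u t) \<partial>lborel) \<partial>\<phi>)"
    by (intro nn_integral_cong) (auto simp: indicator_def space_pair_measure)
  finally show ?thesis .
qed

text \<open>By Fubini's theorem it suffices to bound the lengths of the slices with fixed normal \<open>u\<close>, here by
  an interval that starts at \<open>a u\<close>.  All estimates of \<open>\<Lambda>\<close> rest on this lemma and its converse.\<close>

lemma emeasure_\<Lambda>_le:
  assumes A: "A \<in> sets hyperplane_borel" and B: "B \<in> sets \<phi>" and "l \<ge> 0"
    and slice: "\<And>u t. norm u = 1 \<Longrightarrow> hyperplane u t \<in> A \<Longrightarrow> u \<in> B \<and> a u \<le> t \<and> t \<le> a u + l"
  shows "emeasure \<Lambda> A \<le> ennreal l * emeasure \<phi> B"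
proof -
  have "emeasure \<Lambda> A \<le> (\<integral>\<^sup>+u. ennreal l * indicator B u \<partial>\<phi>)"
    unfolding emeasure_\<Lambda>_eq_integral[OF A]
  proof (rule nn_integral_mono)
    fix u assume "u \<in> space \<phi>"
    then have u: "norm u = 1" by (simp add: space_\<phi>)
    have "(\<integral>\<^sup>+t. indicator A (hyperplane u t) \<partial>lborel) \<le> (\<integral>\<^sup>+t. indicator B u * indicator {a u .. a u + l} t \<partial>lborel)"
      using slice[OF u] by (intro nn_integral_mono) (auto simp: indicator_def)
    also have "\<dots> = ennreal l * indicator B u"
      using \<open>l \<ge> 0\<close> by (simp add: nn_integral_cmult_indicator mult.commute)
    finally show "(\<integral>\<^sup>+t. indicator A (hyperplane u t) \<partial>lborel) \<le> ennreal l * indicator B u" .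
  qed
  also have "\<dots> = ennreal l * emeasure \<phi> B" using B by (simp add: nn_integral_cmult_indicator)
  finally show ?thesis .
qed

lemma emeasure_\<Lambda>_ge:
  assumes A: "A \<in> sets hyperplane_borel" and B: "B \<in> sets \<phi>" and "l \<ge> 0"
    and slice: "\<And>u t. u \<in> B \<Longrightarrow> norm u = 1 \<Longrightarrow> a u < t \<Longrightarrow> t < a u + l \<Longrightarrow> hyperplane u t \<in> A"
  shows "ennreal l * emeasure \<phi> B \<le> emeasure \<Lambda> A"
proof -
  have "ennreal l * emeasure \<phi> B = (\<integral>\<^sup>+u. ennreal l * indicator B u \<partial>\<phi>)"
    using B by (simp add: nn_integral_cmult_indicator)
  also have "\<dots> \<le> emeasure \<Lambda> A"
    unfolding emeasure_\<Lambda>_eq_integral[OF A]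
  proof (rule nn_integral_mono)
    fix u assume "u \<in> space \<phi>"
    then have u: "norm u = 1" by (simp add: space_\<phi>)
    have "ennreal l * indicator B u = (\<integral>\<^sup>+t. indicator B u * indicator {a u <..< a u + l} t \<partial>lborel)"
      using \<open>l \<ge> 0\<close> by (simp add: nn_integral_cmult_indicator mult.commute)
    also have "\<dots> \<le> (\<integral>\<^sup>+t. indicator A (hyperplane u t) \<partial>lborel)"
      using slice u by (intro nn_integral_mono) (auto simp: indicator_def)
    finally show "ennreal l * indicator B u \<le> (\<integral>\<^sup>+t. indicator A (hyperplane u t) \<partial>lborel)" .
  qed
  finally show ?thesis .
qed

lemma hyperplane_in_ball_iff:
  assumes "norm u = 1"
  shows "hyperplane u t \<in> hyperplanes_of (ball_params z R) \<longleftrightarrow> \<bar>t - u \<bullet> z\<bar> < R"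
  using assms by (auto simp: hyperplane_in_hyperplanes_of_iff ball_params_def abs_minus_commute)

lemma emeasure_ball_hyperplanes_le:
  assumes "R \<ge> 0"
  shows "emeasure \<Lambda> (hyperplanes_of (ball_params z R)) \<le> ennreal (2 * R)"
proof -
  have "emeasure \<Lambda> (hyperplanes_of (ball_params z R)) \<le> ennreal (2 * R) * emeasure \<phi> (space \<phi>)"
    using assms by (intro emeasure_\<Lambda>_le[where a = "\<lambda>u. u \<bullet> z - R"])
      (use sets.top[of \<phi>] in \<open>auto simp: hyperplane_in_ball_iff space_\<phi>\<close>)
  then show ?thesis by (simp add: emeasure_space_1)
qed

text \<open>A hyperplane meeting both balls has its normal in a band around the great subsphere orthogonal
  to the line through the centres.\<close>

lemma emeasure_two_balls_le:
  assumes "R \<ge> 0"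
  shows "emeasure \<Lambda> (hyperplanes_of (ball_params z R) \<inter> hyperplanes_of (ball_params w R))
    \<le> ennreal (2 * R) * emeasure \<phi> ({u. \<bar>u \<bullet> (z - w)\<bar> \<le> 2 * R} \<inter> sphere 0 1)"
proof (rule emeasure_\<Lambda>_le[where a = "\<lambda>u. u \<bullet> z - R"])
  have "closed {u::'a. \<bar>u \<bullet> (z - w)\<bar> \<le> 2 * R}"
    by (intro closed_Collect_le continuous_intros)
  then show "{u. \<bar>u \<bullet> (z - w)\<bar> \<le> 2 * R} \<inter> sphere 0 1 \<in> sets \<phi>"
    by (intro Int_sphere_measurable) simp
  show "u \<in> {u. \<bar>u \<bullet> (z - w)\<bar> \<le> 2 * R} \<inter> sphere 0 1 \<and> u \<bullet> z - R \<le> t \<and> t \<le> u \<bullet> z - R + 2 * R"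
    if "norm u = 1" "hyperplane u t \<in> hyperplanes_of (ball_params z R) \<inter> hyperplanes_of (ball_params w R)" for u t
    using that by (auto simp: hyperplane_in_ball_iff inner_diff_right)
qed (use assms in auto)

lemma emeasure_facet_hyperplanes_ge:
  assumes "\<eta> > 0"
  shows "ennreal (2 * \<eta>) * emeasure \<phi> (ball u \<eta> \<inter> sphere 0 1) \<le> emeasure \<Lambda> (hyperplanes_of (facet_params u h \<eta> z))"
proof (rule emeasure_\<Lambda>_ge[where a = "\<lambda>v. v \<bullet> z + h - \<eta>"])
  show "ball u \<eta> \<inter> sphere 0 1 \<in> sets \<phi>" by (intro Int_sphere_measurable) simp
  show "hyperplane v t \<in> hyperplanes_of (facet_params u h \<eta> z)"
    if "v \<in> ball u \<eta> \<inter> sphere 0 1" "norm v = 1" "v \<bullet> z + h - \<eta> < t" "t < v \<bullet> z + h - \<eta> + 2 * \<eta>" for v t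
    using that by (auto simp: hyperplane_in_hyperplanes_of_iff facet_params_def dist_commute)
qed (use assms in auto)

lemma emeasure_ball_Int_sphere_pos:
  assumes "norm u = 1" "\<eta> > 0"
  shows "emeasure \<phi> (ball u \<eta> \<inter> sphere 0 1) > 0"
proof -
  have "u \<in> measure_support \<phi>" using assms by (simp add: support_\<phi>)
  then have "\<forall>U. open U \<and> u \<in> U \<longrightarrow> emeasure \<phi> (U \<inter> sphere 0 1) > 0"
    unfolding measure_support_def space_\<phi> by blast
  then show ?thesis using assms by simp
qed

text \<open>The bands decrease, and their intersection lies in a great subsphere, which is a null set.\<close>

lemma band_measure_tendsto_0:
  assumes v: "norm v = 1"
  shows "(\<lambda>n. emeasure \<phi> ({u. \<bar>u \<bullet> (real n *\<^sub>R v)\<bar> \<le> r} \<inter> sphere 0 1)) \<longlonglongrightarrow> 0"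
proof -
  let ?B = "\<lambda>n. {u. \<bar>u \<bullet> (real n *\<^sub>R v)\<bar> \<le> r} \<inter> sphere 0 1"
  have "(\<lambda>n. emeasure \<phi> (?B n)) \<longlonglongrightarrow> emeasure \<phi> (\<Inter>n. ?B n)"
  proof (rule Lim_emeasure_decseq)
    have "closed {u::'a. \<bar>u \<bullet> (real n *\<^sub>R v)\<bar> \<le> r}" for n
      by (intro closed_Collect_le continuous_intros)
    then show "range ?B \<subseteq> sets \<phi>" by (auto intro!: Int_sphere_measurable)
    show "decseq ?B"
    proof (rule decseq_SucI)
      fix n
      have "real n * \<bar>u \<bullet> v\<bar> \<le> (1 + real n) * \<bar>u \<bullet> v\<bar>" for u :: 'a by (rule mult_right_mono) auto
      then have "real n * \<bar>u \<bullet> v\<bar> \<le> r" if "(1 + real n) * \<bar>u \<bullet> v\<bar> \<le> r" for u :: 'a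
        using that order_trans by blast
      then show "?B (Suc n) \<le> ?B n" by (auto simp: abs_mult)
    qed
  qed simp
  moreover have "emeasure \<phi> (\<Inter>n. ?B n) \<le> emeasure \<phi> ({x. v \<bullet> x = 0} \<inter> sphere 0 1)"
  proof (rule emeasure_mono)
    have "closed {x. v \<bullet> x = 0}" by (rule closed_hyperplane)
    then show "{x. v \<bullet> x = 0} \<inter> sphere 0 1 \<in> sets \<phi>" by (intro Int_sphere_measurable) simp
    show "(\<Inter>n. ?B n) \<subseteq> {x. v \<bullet> x = 0} \<inter> sphere 0 1"
    proof
      fix u assume u: "u \<in> (\<Inter>n. ?B n)"
      then have *: "real n * \<bar>u \<bullet> v\<bar> \<le> r" for n by (auto simp: abs_mult)
      have "u \<bullet> v = 0"
      proof (rule ccontr)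
        assume "u \<bullet> v \<noteq> 0"
        then obtain n where "r < real n * \<bar>u \<bullet> v\<bar>" using reals_Archimedean3 by (metis zero_less_abs_iff)
        with *[of n] show False by simp
      qed
      with u show "u \<in> {x. v \<bullet> x = 0} \<inter> sphere 0 1" by (auto simp: inner_commute)
    qed
  qed
  ultimately show ?thesis using great_subsphere_null[OF v] by simp
qed

text \<open>The centres lie on a line, and the distance from the \<open>k\<close>-th centre to all earlier ones is so large
  that the hyperplanes shared by its ball with each of the \<open>k\<close> earlier balls have measure at most
  \<open>c (1/2)\<^bsup>k+1\<^esup> / (k + 1)\<close>.  Summing over all pairs gives at most \<open>c\<close>.\<close>

lemma sparse_centres:
  assumes R: "R \<ge> 0" and c: "c > 0"
  obtains z :: "nat \<Rightarrow> 'a" and W where "W \<in> sets hyperplane_borel" "emeasure \<Lambda> W \<le> ennreal c"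
    "\<And>j k. j \<noteq> k \<Longrightarrow>
      hyperplanes_of (ball_params (z j) R) \<inter> hyperplanes_of (ball_params (z k) R) \<subseteq> W"
proof -
  obtain v :: 'a where v: "norm v = 1" using vector_choose_size[of 1] by auto
  define B where "B \<rho> = {u. \<bar>u \<bullet> (\<rho> *\<^sub>R v)\<bar> \<le> 2 * R} \<inter> sphere 0 1" for \<rho>
  have B_meas: "B \<rho> \<in> sets \<phi>" for \<rho>
  proof -
    have "closed {u::'a. \<bar>u \<bullet> (\<rho> *\<^sub>R v)\<bar> \<le> 2 * R}" by (intro closed_Collect_le continuous_intros)
    then show ?thesis unfolding B_def by (intro Int_sphere_measurable) simp
  qed
  have "\<exists>n. ennreal (2 * R) * emeasure \<phi> (B (real n)) < e" if e: "e > 0" for e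
  proof -
    have "(\<lambda>n. ennreal (2 * R) * emeasure \<phi> (B (real n))) \<longlonglongrightarrow> ennreal (2 * R) * 0"
      unfolding B_def by (intro tendsto_mult_ennreal tendsto_const band_measure_tendsto_0 v) auto
    then have "(\<lambda>n. ennreal (2 * R) * emeasure \<phi> (B (real n))) \<longlonglongrightarrow> 0" by simp
    from order_tendstoD(2)[OF this e] show ?thesis by (auto simp: eventually_sequentially)
  qed
  then have "\<forall>k. \<exists>n. ennreal (2 * R) * emeasure \<phi> (B (real n)) < ennreal (c * (1/2) ^ Suc k / (k + 1))"
    using c by simp
  then obtain \<rho> :: "nat \<Rightarrow> nat" where
    \<rho>: "\<And>k. ennreal (2 * R) * emeasure \<phi> (B (real (\<rho> k))) < ennreal (c * (1/2) ^ Suc k / (k + 1))"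
    by metis
  \<comment> \<open>partial sums, so that the distance between the centres \<open>j < k\<close> is at least \<open>\<rho> k\<close>\<close>
  define r where "r k = real (\<Sum>i\<le>k. \<rho> i)" for k
  define z where "z k = r k *\<^sub>R v" for k
  define D where "D k = hyperplanes_of (ball_params (z k) R)" for k
  have D_meas: "D k \<in> sets hyperplane_borel" for k by (simp add: D_def)
  have pair: "emeasure \<Lambda> (D j \<inter> D k) \<le> ennreal (c * (1/2) ^ Suc k / (k + 1))" if "j < k" for j k
  proof -
    have "sum \<rho> {..j} + \<rho> k = sum \<rho> (insert k {..j})" using that by simp
    also have "\<dots> \<le> sum \<rho> {..k}" using that by (intro sum_mono2) auto
    finally have "real (\<rho> k) \<le> r k - r j" unfolding r_def by linarith
    then have "\<bar>u \<bullet> (real (\<rho> k) *\<^sub>R v)\<bar> \<le> \<bar>u \<bullet> ((r j - r k) *\<^sub>R v)\<bar>" for u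
      by (simp add: abs_mult) (intro mult_right_mono, auto)
    then have sub: "B (r j - r k) \<subseteq> B (real (\<rho> k))" unfolding B_def by (auto intro: order_trans)
    have "emeasure \<Lambda> (D j \<inter> D k) \<le> ennreal (2 * R) * emeasure \<phi> (B (r j - r k))"
      using emeasure_two_balls_le[OF R, of "z j" "z k"] by (simp add: D_def B_def z_def scaleR_diff_left)
    also have "\<dots> \<le> ennreal (2 * R) * emeasure \<phi> (B (real (\<rho> k)))"
      by (intro mult_left_mono emeasure_mono sub B_meas) simp
    finally show ?thesis using \<rho>[of k] by simp
  qed
  define V where "V k = (\<Union>j<k. D j \<inter> D k)" for k
  have V_meas: "V k \<in> sets hyperplane_borel" for k
    unfolding V_def by (intro sets.finite_UN sets.Int D_meas) auto
  have V_le: "emeasure \<Lambda> (V k) \<le> ennreal (c * (1/2) ^ Suc k)" for k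
  proof -
    have "emeasure \<Lambda> (V k) \<le> (\<Sum>j<k. emeasure \<Lambda> (D j \<inter> D k))"
      unfolding V_def by (rule emeasure_subadditive_finite) (auto simp: D_meas)
    also have "\<dots> \<le> (\<Sum>j<k. ennreal (c * (1/2) ^ Suc k / (k + 1)))"
      by (intro sum_mono pair) auto
    also have "\<dots> = ennreal (k * (c * (1/2) ^ Suc k / (k + 1)))"
      using c by (subst ennreal_mult) (auto simp: ennreal_of_nat_eq_real_of_nat)
    also have "\<dots> \<le> ennreal (c * (1/2) ^ Suc k)"
      using c by (intro ennreal_leI) (simp add: divide_simps)
    finally show ?thesis .
  qed
  have "emeasure \<Lambda> (\<Union>k. V k) \<le> (\<Sum>k. emeasure \<Lambda> (V k))"
    by (rule emeasure_subadditive_countably) (auto simp: V_meas)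
  also have "\<dots> \<le> (\<Sum>k. ennreal (c * (1/2) ^ Suc k))" by (intro suminf_le V_le) auto
  also have "\<dots> = ennreal c"
    using c sums_mult[OF power_half_series, of c] by (intro suminf_ennreal_eq) auto
  finally have "emeasure \<Lambda> (\<Union>k. V k) \<le> ennreal c" .
  moreover have "D j \<inter> D k \<subseteq> (\<Union>k. V k)" if "j \<noteq> k" for j k
    using that unfolding V_def by (cases "j < k") (auto simp: not_less_iff_gr_or_eq)
  ultimately show ?thesis
    using V_meas by (intro that[of "\<Union>k. V k" z]) (auto simp: D_def)
qed

end

section \<open>Independence and void probabilities\<close>

lemma space_system_space: "space system_space = locally_finite_systems"
  unfolding system_space_def by (rule space_measure_of_conv)

lemma sets_system_space: "sets system_space = sigma_sets locally_finite_systems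
     {{S \<in> locally_finite_systems. num_elems (S \<inter> A) \<in> B} | A B.
        A \<in> sets hyperplane_borel \<and> B \<in> sets borel}"
  unfolding system_space_def by (intro sets_measure_of) auto

lemma num_elems_eq_0_iff: "num_elems S = 0 \<longleftrightarrow> S = {}"
  by (auto simp: num_elems_def emeasure_count_space)

lemma void_set_measurable:
  assumes "A \<in> sets hyperplane_borel"
  shows "{S \<in> space system_space. S \<inter> A = {}} \<in> sets system_space"
proof -
  have "{S \<in> locally_finite_systems. num_elems (S \<inter> A) \<in> {0}} \<in> sets system_space"
    unfolding sets_system_space using assms
    by (intro sigma_sets.Basic CollectI exI[of _ A] exI[of _ "{0}"]) auto
  then show ?thesis by (simp add: num_elems_eq_0_iff space_system_space)
qed

definition pattern :: "'b set \<Rightarrow> ('b \<Rightarrow> 'a::euclidean_space set set) \<Rightarrow> 'a set set \<Rightarrow> 'a set set \<Rightarrow> bool" where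
  "pattern U A Q S \<longleftrightarrow> (\<forall>u\<in>U. S \<inter> A u \<noteq> {}) \<and> S \<inter> Q = {}"

lemma pattern_measurable:
  assumes "finite U" "\<And>u. u \<in> U \<Longrightarrow> A u \<in> sets hyperplane_borel" "Q \<in> sets hyperplane_borel"
  shows "{S \<in> space system_space. pattern U A Q S} \<in> sets system_space"
proof -
  have "{S \<in> space system_space. pattern U A Q S} =
    {S \<in> space system_space. S \<inter> Q = {}} - (\<Union>u\<in>U. {S \<in> space system_space. S \<inter> A u = {}})"
    by (auto simp: pattern_def)
  also have "\<dots> \<in> sets system_space"
    using assms by (intro sets.Diff sets.finite_UN void_set_measurable) auto
  finally show ?thesis .
qed

locale poisson_hyperplanes = prob_space M + directional: directional_distribution \<phi>
  for M :: "'w measure" and \<phi> :: "'a::euclidean_space measure" +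
  fixes X :: "'w \<Rightarrow> 'a set set" and \<gamma> :: real
  assumes X_measurable: "X \<in> measurable M system_space"
    and poisson: "poisson_process M X"
    and \<gamma>_pos: "\<gamma> > 0"
    and intensity_eq: "A \<in> sets hyperplane_borel \<Longrightarrow>
      intensity M X A = ennreal \<gamma> * emeasure (hyperplane_measure \<phi>) A"
begin

abbreviation \<Lambda> :: "'a set measure" where "\<Lambda> \<equiv> hyperplane_measure \<phi>"

lemma X_subset: "\<omega> \<in> space M \<Longrightarrow> X \<omega> \<subseteq> hyperplanes"
  using measurable_space[OF X_measurable] by (auto simp: space_system_space locally_finite_systems_def)

lemma event_of_system:
  assumes "{S \<in> space system_space. P S} \<in> sets system_space"
  shows "{\<omega> \<in> space M. P (X \<omega>)} \<in> events"
proof -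
  have "{\<omega> \<in> space M. P (X \<omega>)} = X -` {S \<in> space system_space. P S} \<inter> space M"
    using measurable_space[OF X_measurable] by auto
  then show ?thesis using measurable_sets[OF X_measurable assms] by simp
qed

lemmas void_event = event_of_system[OF void_set_measurable]

lemma void_probability:
  assumes A: "A \<in> sets hyperplane_borel" and fin: "emeasure \<Lambda> A < \<infinity>"
  shows "prob {\<omega> \<in> space M. X \<omega> \<inter> A = {}} = exp (- \<gamma> * measure \<Lambda> A)"
proof -
  have "intensity M X A < \<infinity>"
    using fin by (simp add: intensity_eq[OF A] ennreal_mult_less_top)
  moreover have "enn2real (intensity M X A) = \<gamma> * measure \<Lambda> A"
    using \<gamma>_pos by (simp add: intensity_eq[OF A] enn2real_mult measure_def)
  ultimately show ?thesis
    using poisson[unfolded poisson_process_def, THEN conjunct1, rule_format, OF A, of 0]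
    by (simp add: num_elems_eq_0_iff)
qed

lemma independent_events:
  fixes D :: "nat \<Rightarrow> 'a set set"
  assumes "\<And>i. D i \<in> sets hyperplane_borel" "disjoint_family D"
    and "\<And>i. {S \<in> space system_space. P i S} \<in> sets system_space"
  shows "indep_events (\<lambda>i. {\<omega> \<in> space M. P i (X \<omega> \<inter> D i)}) UNIV"
proof (rule indep_eventsI_indep_vars[where N = "\<lambda>_. system_space" and X = "\<lambda>i \<omega>. X \<omega> \<inter> D i" and P = P])
  show "indep_vars (\<lambda>_. system_space) (\<lambda>i \<omega>. X \<omega> \<inter> D i) UNIV"
    using poisson assms(1,2) unfolding poisson_process_def by (auto simp: image_subset_iff)
qed (use assms(3) in simp)

text \<open>Independence is available for sequences of disjoint sets, so the finitely many sets \<open>A u\<close> are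
  enumerated after \<open>Q\<close> and followed by empty sets.\<close>

lemma pattern_probability:
  assumes U: "finite U" and A: "\<And>u. u \<in> U \<Longrightarrow> A u \<in> sets hyperplane_borel" and Q: "Q \<in> sets hyperplane_borel"
    and disj: "disjoint_family_on A U" "\<And>u. u \<in> U \<Longrightarrow> A u \<inter> Q = {}"
    and fin: "\<And>u. u \<in> U \<Longrightarrow> emeasure \<Lambda> (A u) < \<infinity>" "emeasure \<Lambda> Q < \<infinity>"
  shows "prob {\<omega> \<in> space M. pattern U A Q (X \<omega>)} =
    exp (- \<gamma> * measure \<Lambda> Q) * (\<Prod>u\<in>U. 1 - exp (- \<gamma> * measure \<Lambda> (A u)))"
proof -
  obtain f where f: "bij_betw f {0..<card U} U" using ex_bij_betw_nat_finite[OF U] by blast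
  define n where "n = card U"
  have fU: "f i \<in> U" if "i < n" for i using f that by (auto simp: bij_betw_def n_def)
  have inj: "f i \<noteq> f j" if "i < n" "j < n" "i \<noteq> j" for i j
    using f that by (auto simp: bij_betw_def inj_on_def n_def)
  define D where "D i = (case i of 0 \<Rightarrow> Q | Suc j \<Rightarrow> if j < n then A (f j) else {})" for i
  define P where "P i S = (case i of 0 \<Rightarrow> S = {} | Suc j \<Rightarrow> S \<noteq> {})" for i and S :: "'a set set"
  define E where "E i = {\<omega> \<in> space M. P i (X \<omega> \<inter> D i)}" for i
  have D_sets: "D i \<in> sets hyperplane_borel" for i
    using A Q fU by (auto simp: D_def split: nat.split)
  have "disjoint_family D"
    unfolding disjoint_family_on_def
  proof (intro ballI impI)
    fix i j :: nat assume "i \<noteq> j"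
    have AA: "A (f i) \<inter> A (f j) = {}" if "i < n" "j < n" "i \<noteq> j" for i j
      using disj(1) fU inj that by (auto simp: disjoint_family_on_def)
    show "D i \<inter> D j = {}"
      using \<open>i \<noteq> j\<close> AA disj(2) fU by (cases i; cases j) (auto simp: D_def)
  qed
  moreover have "{S \<in> space system_space. P i S} \<in> sets system_space" for i
  proof -
    have *: "{S \<in> space system_space. S = {}} \<in> sets (system_space :: 'a set set measure)"
    proof -
      have "{S \<in> space system_space. S = {}} =
          {S \<in> space system_space. S \<inter> space hyperplane_borel = ({} :: 'a set set)}"
        by (auto simp: space_system_space space_hyperplane_borel locally_finite_systems_def)
      then show ?thesis using void_set_measurable[OF sets.top] by (simp only:)
    qed
    have eq: "{S \<in> space system_space. S \<noteq> ({} :: 'a set set)} =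
        space system_space - {S \<in> space system_space. S = {}}" by auto
    have "{S \<in> space system_space. S \<noteq> {}} \<in> sets (system_space :: 'a set set measure)"
      unfolding eq by (rule sets.compl_sets[OF *])
    with * show ?thesis by (cases i) (simp_all add: P_def)
  qed
  ultimately have indep: "indep_events E UNIV"
    unfolding E_def by (intro independent_events D_sets)
  have "{\<omega> \<in> space M. pattern U A Q (X \<omega>)} = (\<Inter>i\<in>{..n}. E i)"
  proof -
    have UI: "U = f ` {..<n}" using f by (auto simp: bij_betw_def n_def lessThan_atLeast0)
    have "(\<Inter>i\<in>{..n}. E i) = E 0 \<inter> (\<Inter>i\<in>{..<n}. E (Suc i))"
      by (auto simp: atMost_Suc_eq_insert_0 lessThan_Suc_atMost[symmetric] lessThan_Suc_eq_insert_0)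
    also have "E 0 \<inter> (\<Inter>i\<in>{..<n}. E (Suc i)) = {\<omega> \<in> space M. pattern U A Q (X \<omega>)}"
      unfolding UI by (auto simp: E_def P_def D_def pattern_def)
    finally show ?thesis by simp
  qed
  also have "prob (\<Inter>i\<in>{..n}. E i) = (\<Prod>i\<in>{..n}. prob (E i))"
    using indep unfolding indep_events_def by blast
  also have "\<dots> = prob (E 0) * (\<Prod>i<n. prob (E (Suc i)))"
    by (rule prod.atMost_shift)
  also have "prob (E 0) = exp (- \<gamma> * measure \<Lambda> Q)"
    using void_probability[OF Q fin(2)] by (simp add: E_def P_def D_def)
  also have "(\<Prod>i<n. prob (E (Suc i))) = (\<Prod>i<n. 1 - exp (- \<gamma> * measure \<Lambda> (A (f i))))"
  proof (rule prod.cong)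
    fix i assume "i \<in> {..<n}"
    then have i: "i < n" by simp
    note Ai = A[OF fU[OF i]]
    have "E (Suc i) = space M - {\<omega> \<in> space M. X \<omega> \<inter> A (f i) = {}}"
      using i by (auto simp: E_def P_def D_def)
    then show "prob (E (Suc i)) = 1 - exp (- \<gamma> * measure \<Lambda> (A (f i)))"
      using prob_compl[OF void_event[OF Ai]] void_probability[OF Ai fin(1)[OF fU[OF i]]] by simp
  qed simp
  also have "\<dots> = (\<Prod>u\<in>U. 1 - exp (- \<gamma> * measure \<Lambda> (A u)))"
    using prod.reindex_bij_betw[OF f, of "\<lambda>u. 1 - exp (- \<gamma> * measure \<Lambda> (A u))"]
    by (simp add: n_def lessThan_atLeast0)
  finally show ?thesis .
qed

text \<open>The trials depend on the restrictions of the process to disjoint sets, so they are independent,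
  and \<open>n\<close> of them fail with probability at most \<open>(1 - q)\<^sup>n\<close>.\<close>

lemma AE_some_trial_succeeds:
  fixes D :: "nat \<Rightarrow> 'a set set"
  assumes D: "\<And>k. D k \<in> sets hyperplane_borel" "disjoint_family D"
    and P: "\<And>k. {S \<in> space system_space. P k S} \<in> sets system_space"
    and q: "q > 0" "\<And>k. q \<le> prob {\<omega> \<in> space M. P k (X \<omega> \<inter> D k)}"
  shows "AE \<omega> in M. \<exists>k. P k (X \<omega> \<inter> D k)"
proof -
  define E where "E k = {\<omega> \<in> space M. \<not> P k (X \<omega> \<inter> D k)}" for k
  have notP: "{S \<in> space system_space. \<not> P k S} \<in> sets system_space" for k
  proof -
    have "{S \<in> space system_space. \<not> P k S} = space system_space - {S \<in> space system_space. P k S}" by auto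
    then show ?thesis using P by simp
  qed
  have "indep_events (\<lambda>k. {\<omega> \<in> space M. P k (X \<omega> \<inter> D k)}) UNIV"
    by (rule independent_events[OF D P])
  then have ev: "{\<omega> \<in> space M. P k (X \<omega> \<inter> D k)} \<in> events" for k
    by (auto simp: indep_events_def)
  have indep: "indep_events E UNIV"
    unfolding E_def by (rule independent_events[OF D notP])
  then have E_ev: "E k \<in> events" for k by (auto simp: indep_events_def)
  have E_le: "prob (E k) \<le> 1 - q" for k
  proof -
    have "E k = space M - {\<omega> \<in> space M. P k (X \<omega> \<inter> D k)}" by (auto simp: E_def)
    then show ?thesis using prob_compl[OF ev[of k]] q(2)[of k] by simp
  qed
  have q1: "0 \<le> 1 - q" using order_trans[OF q(2)[of 0] prob_le_1] by simp
  have "prob (\<Inter>k. E k) \<le> (1 - q) ^ Suc n" for n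
  proof -
    have "prob (\<Inter>k. E k) \<le> prob (\<Inter>k\<in>{..n}. E k)"
      by (rule finite_measure_mono) (auto intro!: sets.finite_INT E_ev)
    also have "\<dots> = (\<Prod>k\<in>{..n}. prob (E k))" using indep unfolding indep_events_def by blast
    also have "\<dots> \<le> (\<Prod>k\<in>{..n}. 1 - q)" by (intro prod_mono) (auto simp: E_le)
    finally show ?thesis by simp
  qed
  moreover have "(\<lambda>n. (1 - q) ^ Suc n) \<longlonglongrightarrow> 0"
    using q1 q(1) by (intro LIMSEQ_Suc LIMSEQ_realpow_zero) auto
  ultimately have "prob (\<Inter>k. E k) \<le> 0" by (intro LIMSEQ_le_const) auto
  then have "prob (\<Inter>k. E k) = 0" by (simp add: measure_le_0_iff)
  moreover have "(\<Inter>k. E k) \<in> events" using E_ev by (intro sets.countable_INT) auto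
  ultimately have "(\<Inter>k. E k) \<in> null_sets M" by (simp add: null_sets_def emeasure_eq_measure)
  then show ?thesis by (rule AE_I') (auto simp: E_def)
qed

section \<open>Almost sure properties of the cells\<close>

text \<open>The hyperplanes in question have infinite measure: the slabs \<open>r < t < r + m\<close> have finite
  measure of at least \<open>p m\<close>, and so contain no hyperplane of the process with probability at most
  \<open>exp (- \<gamma> p m)\<close>.\<close>

lemma AE_hit_exits:
  assumes e: "norm e = 1" and r: "r \<ge> 0"
  shows "AE \<omega> in M. X \<omega> \<inter> hyperplanes_of (exits e r) \<noteq> {}"
proof -
  let ?\<delta> = "1 / (2 * real DIM('a))"
  define p where "p = measure \<phi> (ball e ?\<delta> \<inter> sphere 0 1)"
  have p: "p > 0" using directional.emeasure_ball_Int_sphere_pos[OF e, of ?\<delta>]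
    unfolding p_def by (simp add: directional.emeasure_eq_measure)
  define N where "N m = {(u, t). dist u e < ?\<delta> \<and> r < t \<and> t < r + real m}" for m :: nat
  have N_open: "open (N m)" for m
    unfolding N_def case_prod_unfold by (intro open_Collect_conj open_Collect_less continuous_intros)
  note N_sets = hyperplanes_of_measurable[OF N_open]
  let ?E = "{\<omega> \<in> space M. X \<omega> \<inter> hyperplanes_of (exits e r) = {}}"
  have exits_sets: "hyperplanes_of (exits e r) \<in> sets hyperplane_borel"
    by (rule hyperplanes_of_measurable[OF open_exits])
  have "prob ?E \<le> exp (- (\<gamma> * p)) ^ m" for m
  proof -
    have "N m \<subseteq> ball_params 0 (r + m)" using r by (auto simp: N_def ball_params_def)
    then have sub: "hyperplanes_of (N m) \<subseteq> hyperplanes_of (ball_params 0 (r + m))"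
      unfolding hyperplanes_of_def by blast
    have "emeasure \<Lambda> (hyperplanes_of (N m)) \<le> emeasure \<Lambda> (hyperplanes_of (ball_params 0 (r + m)))"
      by (rule emeasure_mono[OF sub]) simp
    also have "\<dots> \<le> ennreal (2 * (r + m))"
      using r by (intro directional.emeasure_ball_hyperplanes_le) simp
    finally have fin: "emeasure \<Lambda> (hyperplanes_of (N m)) < \<infinity>" by (simp add: le_less_trans)
    have "ennreal (real m) * emeasure \<phi> (ball e ?\<delta> \<inter> sphere 0 1) \<le> emeasure \<Lambda> (hyperplanes_of (N m))"
    proof (rule directional.emeasure_\<Lambda>_ge[OF N_sets, where a = "\<lambda>_. r"])
      show "ball e ?\<delta> \<inter> sphere 0 1 \<in> sets \<phi>" by (intro directional.Int_sphere_measurable) simp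
    qed (auto simp: hyperplane_in_hyperplanes_of_iff N_def dist_commute)
    then have "real m * p \<le> measure \<Lambda> (hyperplanes_of (N m))"
      using fin by (simp add: p_def directional.emeasure_eq_measure ennreal_mult'[symmetric]
        emeasure_eq_ennreal_measure)
    then have le: "exp (- \<gamma> * measure \<Lambda> (hyperplanes_of (N m))) \<le> exp (- (\<gamma> * p)) ^ m"
      using \<gamma>_pos by (simp add: exp_of_nat_mult[symmetric] mult.left_commute)
    have "N m \<subseteq> exits e r" by (auto simp: N_def exits_def)
    then have "hyperplanes_of (N m) \<subseteq> hyperplanes_of (exits e r)" unfolding hyperplanes_of_def by blast
    then have "prob ?E \<le> prob {\<omega> \<in> space M. X \<omega> \<inter> hyperplanes_of (N m) = {}}"
      by (intro finite_measure_mono void_event N_sets) auto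
    also have "\<dots> = exp (- \<gamma> * measure \<Lambda> (hyperplanes_of (N m)))" by (rule void_probability[OF N_sets fin])
    finally show ?thesis using le by simp
  qed
  moreover have "(\<lambda>m. exp (- (\<gamma> * p)) ^ m) \<longlonglongrightarrow> 0"
    using \<gamma>_pos p by (intro LIMSEQ_realpow_zero) auto
  ultimately have "prob ?E \<le> 0" by (intro LIMSEQ_le_const) auto
  then have "?E \<in> null_sets M"
    using void_event[OF exits_sets] by (simp add: null_sets_def emeasure_eq_measure measure_le_0_iff)
  then show ?thesis by (rule AE_I') auto
qed

lemma AE_cells_convex_bodies: "AE \<omega> in M. cells (X \<omega>) \<subseteq> convex_bodies"
proof -
  have "AE \<omega> in M. \<forall>n::nat. \<forall>e\<in>Basis \<union> uminus ` Basis. X \<omega> \<inter> hyperplanes_of (exits e (real n)) \<noteq> {}"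
    unfolding AE_all_countable
    by (intro allI AE_finite_allI) (auto intro!: AE_hit_exits)
  then show ?thesis
    using AE_space by eventually_elim (intro cells_in_convex_bodies X_subset, blast+)
qed

text \<open>For each \<open>n\<close> the trials are made at sparse centres whose exceptional set \<open>W n\<close> has measure at most
  \<open>c n\<close>.  A trial ignores the hyperplanes in \<open>W n\<close>; it agrees with the pattern that is wanted as
  soon as the process avoids \<open>W n\<close>.  Almost surely some trial succeeds for every \<open>n\<close>, and almost
  surely \<open>W n\<close> is avoided for some \<open>n\<close>, since \<open>c n\<close> tends to \<open>0\<close>.\<close>

lemma AE_pattern_somewhere:
  fixes h :: "'a \<Rightarrow> real"
  assumes U: "finite U" "U \<subseteq> sphere 0 1" and \<eta>: "\<eta> > 0" and R: "R \<ge> 0"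
    and h: "\<And>u. u \<in> U \<Longrightarrow> \<eta> < h u \<and> h u + \<eta> \<le> R"
    and sep: "\<And>u u'. u \<in> U \<Longrightarrow> u' \<in> U \<Longrightarrow> u \<noteq> u' \<Longrightarrow> 2 * \<eta> \<le> dist u u'"
  shows "AE \<omega> in M. \<exists>z. (\<forall>u\<in>U. X \<omega> \<inter> hyperplanes_of (facet_params u (h u) \<eta> z) \<noteq> {}) \<and>
    X \<omega> \<inter> hyperplanes_of (ball_params z R) \<subseteq> (\<Union>u\<in>U. hyperplanes_of (facet_params u (h u) \<eta> z))"
proof -
  define A where "A z u = hyperplanes_of (facet_params u (h u) \<eta> z)" for z u
  define B where "B z = hyperplanes_of (ball_params z R)" for z :: 'a
  have A_sets: "A z u \<in> sets hyperplane_borel" for z u by (simp add: A_def)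
  have B_sets: "B z \<in> sets hyperplane_borel" for z by (simp add: B_def)
  have A_sub: "A z u \<subseteq> B z" if "u \<in> U" for z u
    unfolding A_def B_def using h[OF that] by (intro facet_hyperplanes_subset_ball) auto
  have A_disj: "A z u \<inter> A z u' = {}" if "u \<in> U" "u' \<in> U" "u \<noteq> u'" for z u u'
    unfolding A_def using h[OF that(1)] h[OF that(2)] sep[OF that] by (intro facet_hyperplanes_disjoint) auto
  have B_le: "emeasure \<Lambda> (B z) \<le> ennreal (2 * R)" for z
    unfolding B_def by (rule directional.emeasure_ball_hyperplanes_le[OF R])
  define b where "b u = 2 * \<eta> * measure \<phi> (ball u \<eta> \<inter> sphere 0 1)" for u
  define a where "a = Min (insert 1 (b ` U))"
  have b_pos: "b u > 0" if "u \<in> U" for u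
    using directional.emeasure_ball_Int_sphere_pos[of u \<eta>] that U \<eta>
    by (auto simp: b_def directional.emeasure_eq_measure)
  have a_pos: "a > 0" using U b_pos by (auto simp: a_def)
  have a_le: "a \<le> b u" if "u \<in> U" for u using U that by (auto simp: a_def)
  have A_ge: "ennreal (b u) \<le> emeasure \<Lambda> (A z u)" for z u
    using directional.emeasure_facet_hyperplanes_ge[OF \<eta>, of u "h u" z] \<eta>
    by (simp add: A_def b_def directional.emeasure_eq_measure ennreal_mult)
  define q where "q = exp (- \<gamma> * (2 * R)) * (\<Prod>u\<in>U. 1 - exp (- \<gamma> * (a / 2)))"
  have q: "q > 0" unfolding q_def using \<gamma>_pos a_pos by (intro mult_pos_pos prod_pos) auto
  \<comment> \<open>removing \<open>W n\<close> must leave at least half of the measure of every facet neighbourhood\<close>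
  define c where "c n = min (a / 2) (1 / real (Suc n))" for n
  have c: "c n > 0" for n using a_pos by (simp add: c_def)
  have "\<exists>z W. W \<in> sets hyperplane_borel \<and> emeasure \<Lambda> W \<le> ennreal (c n) \<and>
      (\<forall>j k::nat. j \<noteq> k \<longrightarrow> B (z j) \<inter> B (z k) \<subseteq> W)" for n
    using directional.sparse_centres[OF R c[of n]] unfolding B_def by metis
  then obtain z :: "nat \<Rightarrow> nat \<Rightarrow> 'a" and W where W: "\<And>n. W n \<in> sets hyperplane_borel" "\<And>n. emeasure \<Lambda> (W n) \<le> ennreal (c n)"
    "\<And>n j k. j \<noteq> k \<Longrightarrow> B (z n j) \<inter> B (z n k) \<subseteq> W n"
    by metis
  have trial: "AE \<omega> in M. \<exists>k. pattern U (\<lambda>u. A (z n k) u - W n)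
      (B (z n k) - W n - (\<Union>u\<in>U. A (z n k) u)) (X \<omega> \<inter> (B (z n k) - W n))" for n
  proof (rule AE_some_trial_succeeds[OF _ _ _ q])
    show "B (z n k) - W n \<in> sets hyperplane_borel" for k using B_sets W by simp
    show "disjoint_family (\<lambda>k. B (z n k) - W n)"
      using W(3)[of _ _ n] unfolding disjoint_family_on_def by blast
    fix k
    let ?A = "\<lambda>u. A (z n k) u - W n" and ?Q = "B (z n k) - W n - (\<Union>u\<in>U. A (z n k) u)"
    have Q_sets: "?Q \<in> sets hyperplane_borel"
      using U(1) by (intro sets.Diff sets.finite_UN B_sets A_sets W)
    show "{S \<in> space system_space. pattern U ?A ?Q S} \<in> sets system_space"
      by (intro pattern_measurable U Q_sets sets.Diff A_sets W)
    have fin: "emeasure \<Lambda> Y < \<infinity> \<and> measure \<Lambda> Y \<le> 2 * R" if "Y \<subseteq> B (z n k)" for Y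
    proof -
      have "emeasure \<Lambda> Y \<le> ennreal (2 * R)"
        using emeasure_mono[OF that, of \<Lambda>] B_sets B_le[of "z n k"] by (auto intro: order_trans)
      then show ?thesis using R by (auto simp: measure_def enn2real_leI intro: le_less_trans)
    qed
    have finA: "emeasure \<Lambda> (?A u) < \<infinity>" if "u \<in> U" for u using fin[of "?A u"] A_sub[OF that] by blast
    have "prob {\<omega> \<in> space M. pattern U ?A ?Q (X \<omega>)} =
      exp (- \<gamma> * measure \<Lambda> ?Q) * (\<Prod>u\<in>U. 1 - exp (- \<gamma> * measure \<Lambda> (?A u)))"
    proof (rule pattern_probability)
      show "disjoint_family_on ?A U" using A_disj unfolding disjoint_family_on_def by blast
      show "emeasure \<Lambda> ?Q < \<infinity>" using fin[of ?Q] by blast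
    qed (use U A_sets W Q_sets finA in auto)
    moreover have "q \<le> exp (- \<gamma> * measure \<Lambda> ?Q) * (\<Prod>u\<in>U. 1 - exp (- \<gamma> * measure \<Lambda> (?A u)))"
      unfolding q_def
    proof (rule mult_mono)
      have "measure \<Lambda> ?Q \<le> 2 * R" using fin[of ?Q] by blast
      then show "exp (- \<gamma> * (2 * R)) \<le> exp (- \<gamma> * measure \<Lambda> ?Q)" using \<gamma>_pos by simp
      show "(\<Prod>u\<in>U. 1 - exp (- \<gamma> * (a / 2))) \<le> (\<Prod>u\<in>U. 1 - exp (- \<gamma> * measure \<Lambda> (?A u)))"
      proof (rule prod_mono)
        fix u assume u: "u \<in> U"
        have "ennreal a \<le> emeasure \<Lambda> (A (z n k) u)"
          using A_ge a_le[OF u] by (meson ennreal_leI order_trans)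
        also have "\<dots> \<le> emeasure \<Lambda> (?A u \<union> W n)" using A_sets W by (intro emeasure_mono) auto
        also have "\<dots> \<le> emeasure \<Lambda> (?A u) + emeasure \<Lambda> (W n)"
          using A_sets W by (intro emeasure_subadditive) auto
        also have "\<dots> \<le> ennreal (measure \<Lambda> (?A u)) + ennreal (a / 2)"
        proof (rule add_mono)
          show "emeasure \<Lambda> (?A u) \<le> ennreal (measure \<Lambda> (?A u))"
            using finA[OF u] by (simp add: emeasure_eq_ennreal_measure)
          have "ennreal (c n) \<le> ennreal (a / 2)" by (intro ennreal_leI) (simp add: c_def)
          then show "emeasure \<Lambda> (W n) \<le> ennreal (a / 2)" using W(2)[of n] by (rule order_trans[rotated])
        qed
        also have "\<dots> = ennreal (measure \<Lambda> (?A u) + a / 2)" using a_pos by (simp add: ennreal_plus)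
        finally have "a \<le> measure \<Lambda> (?A u) + a / 2" using a_pos by (subst (asm) ennreal_le_iff) auto
        then have "\<gamma> * (a / 2) \<le> \<gamma> * measure \<Lambda> (?A u)" using \<gamma>_pos by (intro mult_left_mono) auto
        then show "0 \<le> 1 - exp (- \<gamma> * (a / 2)) \<and>
            1 - exp (- \<gamma> * (a / 2)) \<le> 1 - exp (- \<gamma> * measure \<Lambda> (?A u))"
          using \<gamma>_pos a_pos by simp
      qed
    qed (use \<gamma>_pos a_pos in \<open>auto intro!: prod_nonneg\<close>)
    \<comment> \<open>the pattern only concerns hyperplanes in \<open>B (z n k) - W n\<close>, because the facet neighbourhoods lie in \<open>B (z n k)\<close>\<close>
    moreover have "pattern U ?A ?Q (X \<omega> \<inter> (B (z n k) - W n)) \<longleftrightarrow> pattern U ?A ?Q (X \<omega>)" for \<omega>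
    proof -
      have "X \<omega> \<inter> (B (z n k) - W n) \<inter> ?A u = X \<omega> \<inter> ?A u" if "u \<in> U" for u using A_sub[OF that] by blast
      moreover have "X \<omega> \<inter> (B (z n k) - W n) \<inter> ?Q = X \<omega> \<inter> ?Q" by blast
      ultimately show ?thesis unfolding pattern_def by simp
    qed
    ultimately show "q \<le> prob {\<omega> \<in> space M. pattern U ?A ?Q (X \<omega> \<inter> (B (z n k) - W n))}" by simp
  qed
  have void: "AE \<omega> in M. \<exists>n. X \<omega> \<inter> W n = {}"
  proof -
    define E where "E n = space M - {\<omega> \<in> space M. X \<omega> \<inter> W n = {}}" for n
    have E_ev: "E n \<in> events" for n unfolding E_def by (intro sets.Diff sets.top void_event W)
    have "prob (\<Inter>n. E n) \<le> \<gamma> * (1 / real (Suc n))" for n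
    proof -
      have fin: "emeasure \<Lambda> (W n) < \<infinity>" using W(2)[of n] by (auto intro: le_less_trans)
      have "measure \<Lambda> (W n) \<le> c n" using W(2)[of n] c[of n] by (simp add: measure_def enn2real_leI)
      then have mW: "measure \<Lambda> (W n) \<le> 1 / real (Suc n)" by (simp add: c_def)
      have "prob (\<Inter>n. E n) \<le> prob (E n)" by (intro finite_measure_mono E_ev) auto
      also have "\<dots> = 1 - exp (- \<gamma> * measure \<Lambda> (W n))"
        unfolding E_def prob_compl[OF void_event[OF W(1)]] void_probability[OF W(1) fin] ..
      also have "\<dots> \<le> \<gamma> * measure \<Lambda> (W n)"
        using exp_ge_add_one_self[of "- \<gamma> * measure \<Lambda> (W n)"] by simp
      also have "\<dots> \<le> \<gamma> * (1 / real (Suc n))" using \<gamma>_pos mW by (intro mult_left_mono) auto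
      finally show ?thesis .
    qed
    moreover have "(\<lambda>n. \<gamma> * (1 / real (Suc n))) \<longlonglongrightarrow> \<gamma> * 0"
      using LIMSEQ_inverse_real_of_nat by (intro tendsto_mult tendsto_const) (simp add: inverse_eq_divide)
    ultimately have "prob (\<Inter>n. E n) \<le> \<gamma> * 0" by (intro LIMSEQ_le_const) auto
    moreover have "(\<Inter>n. E n) \<in> events" using E_ev by (intro sets.countable_INT) auto
    ultimately have "(\<Inter>n. E n) \<in> null_sets M"
      by (simp add: null_sets_def emeasure_eq_measure measure_le_0_iff)
    then show ?thesis by (rule AE_I') (auto simp: E_def)
  qed
  have "AE \<omega> in M. \<forall>n. \<exists>k. pattern U (\<lambda>u. A (z n k) u - W n)
      (B (z n k) - W n - (\<Union>u\<in>U. A (z n k) u)) (X \<omega> \<inter> (B (z n k) - W n))"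
    unfolding AE_all_countable using trial by blast
  with void show ?thesis
  proof eventually_elim
    case (elim \<omega>)
    then obtain n where n: "X \<omega> \<inter> W n = {}" by blast
    with elim(2) obtain k where k: "pattern U (\<lambda>u. A (z n k) u - W n)
      (B (z n k) - W n - (\<Union>u\<in>U. A (z n k) u)) (X \<omega> \<inter> (B (z n k) - W n))" by blast
    have "\<forall>u\<in>U. X \<omega> \<inter> A (z n k) u \<noteq> {}" using k unfolding pattern_def by blast
    moreover have "X \<omega> \<inter> B (z n k) \<subseteq> (\<Union>u\<in>U. A (z n k) u)" using k n unfolding pattern_def by blast
    ultimately show ?case unfolding A_def B_def by blast
  qed
qed

end

section \<open>Density of the translated cells\<close>

lemma convex_body_translation:
  "K \<in> convex_bodies \<Longrightarrow> (+) x ` K \<in> convex_bodies"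
  by (simp add: convex_bodies_def compact_translation convex_translation)

text \<open>A finite net of \<open>K\<close> with points in \<open>D\<close>, discarding those that are not close to \<open>K\<close>.  The hull of
  the net stays in the parallel body of \<open>K\<close>, which is convex.\<close>

lemma convex_hull_dense_in_convex_bodies:
  fixes K :: "'a::euclidean_space set"
  assumes D: "\<And>U :: 'a set. open U \<Longrightarrow> U \<noteq> {} \<Longrightarrow> \<exists>d\<in>D. d \<in> U"
    and K: "K \<in> convex_bodies" and e: "e > 0"
  obtains F where "finite F" "F \<subseteq> D" "F \<noteq> {}" "hausdorff_distance K (convex hull F) < e"
proof -
  have cK: "compact K" "convex K" "K \<noteq> {}" using K by (auto simp: convex_bodies_def)
  have "K \<subseteq> (\<Union>q\<in>D. ball q (e / 2))"
  proof
    fix x assume "x \<in> K"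
    obtain d where "d \<in> D" "d \<in> ball x (e / 2)" using D[of "ball x (e / 2)"] e by auto
    then show "x \<in> (\<Union>q\<in>D. ball q (e / 2))" by (auto simp: dist_commute)
  qed
  then obtain G where G: "G \<subseteq> D" "finite G" "K \<subseteq> (\<Union>q\<in>G. ball q (e / 2))"
    by (rule compactE_image[OF cK(1), rotated]) auto
  define F where "F = {q \<in> G. ball q (e / 2) \<inter> K \<noteq> {}}"
  have F: "finite F" "F \<subseteq> D" using G by (auto simp: F_def)
  have near: "\<exists>q\<in>F. dist x q < e / 2" if "x \<in> K" for x
    using that G(3) by (force simp: F_def dist_commute)
  then have F_ne: "F \<noteq> {}" using cK(3) by blast
  have "F \<subseteq> (\<Union>x\<in>K. \<Union>b\<in>cball 0 (e / 2). {x + b})"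
  proof
    fix q assume "q \<in> F"
    then obtain x where x: "x \<in> K" "dist q x < e / 2" by (auto simp: F_def)
    then have "q - x \<in> cball 0 (e / 2)" "q = x + (q - x)" by (simp_all add: dist_norm norm_minus_commute)
    with x(1) show "q \<in> (\<Union>x\<in>K. \<Union>b\<in>cball 0 (e / 2). {x + b})" by blast
  qed
  then have hull_sub: "convex hull F \<subseteq> (\<Union>x\<in>K. \<Union>b\<in>cball 0 (e / 2). {x + b})"
    by (intro hull_minimal convex_sums cK(2) convex_cball)
  have hull: "convex hull F \<in> convex_bodies"
    using F(1) F_ne by (simp add: convex_bodies_def finite_imp_compact_convex_hull convex_convex_hull)
  have "hausdorff_distance K (convex hull F) < e"
    unfolding hausdorff_distance_less_iff[OF K hull]
  proof (intro exI[of _ "e / 2"] conjI ballI)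
    show "\<exists>y\<in>convex hull F. dist x y \<le> e / 2" if x: "x \<in> K" for x
      using near[OF x] hull_inc[of _ F convex] by (meson less_imp_le)
    show "\<exists>x\<in>K. dist y x \<le> e / 2" if y: "y \<in> convex hull F" for y
    proof -
      obtain x b where "x \<in> K" "norm b \<le> e / 2" "y = x + b" using y hull_sub by auto
      then show ?thesis by (intro bexI[of _ x]) (simp_all add: dist_norm)
    qed
  qed (use e in auto)
  then show ?thesis using that F F_ne by blast
qed

context poisson_hyperplanes
begin

lemma AE_cell_close_to_body:
  assumes K: "K \<in> convex_bodies" and e: "e > 0"
  shows "AE \<omega> in M. \<exists>C\<in>translates (cells (X \<omega>)). hausdorff_distance K C < e"
proof -
  obtain p where p: "p \<in> K" using K by (auto simp: convex_bodies_def)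
  \<comment> \<open>cells are prescribed for bodies that contain the origin\<close>
  define K0 where "K0 = (+) (- p) ` K"
  have K0: "K0 \<in> convex_bodies" "0 \<in> K0"
    using p convex_body_translation[OF K, of "- p"] unfolding K0_def by (auto simp: image_iff)
  show ?thesis
  proof (rule prescribed_cell[OF K0 half_gt_zero[OF e]])
    fix U \<eta> R h
    assume U: "finite U" "U \<subseteq> sphere 0 1" "\<eta> > 0" "R \<ge> 0"
      "\<And>u. u \<in> U \<Longrightarrow> \<eta> < h u \<and> h u + \<eta> \<le> R"
      "\<And>u u'. u \<in> U \<Longrightarrow> u' \<in> U \<Longrightarrow> u \<noteq> u' \<Longrightarrow> 2 * \<eta> \<le> dist u u'"
      and cell: "\<And>S z. S \<subseteq> hyperplanes \<Longrightarrow>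
         \<forall>u\<in>U. S \<inter> hyperplanes_of (facet_params u (h u) \<eta> z) \<noteq> {} \<Longrightarrow>
         S \<inter> hyperplanes_of (ball_params z R) \<subseteq> (\<Union>u\<in>U. hyperplanes_of (facet_params u (h u) \<eta> z)) \<Longrightarrow>
         \<exists>C\<in>cells S. (+) z ` K0 \<subseteq> C \<and> (\<forall>x\<in>C. \<exists>y\<in>K0. dist x (z + y) \<le> e / 2)"
    have "AE \<omega> in M. \<exists>z. (\<forall>u\<in>U. X \<omega> \<inter> hyperplanes_of (facet_params u (h u) \<eta> z) \<noteq> {}) \<and>
      X \<omega> \<inter> hyperplanes_of (ball_params z R) \<subseteq> (\<Union>u\<in>U. hyperplanes_of (facet_params u (h u) \<eta> z))"
      by (intro AE_pattern_somewhere U)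
    with AE_cells_convex_bodies AE_space show ?thesis
    proof eventually_elim
      case (elim \<omega>)
      from elim(3) obtain z where
        z: "\<forall>u\<in>U. X \<omega> \<inter> hyperplanes_of (facet_params u (h u) \<eta> z) \<noteq> {}"
        "X \<omega> \<inter> hyperplanes_of (ball_params z R) \<subseteq> (\<Union>u\<in>U. hyperplanes_of (facet_params u (h u) \<eta> z))"
        by blast
      obtain C where C: "C \<in> cells (X \<omega>)" "(+) z ` K0 \<subseteq> C"
        "\<And>x. x \<in> C \<Longrightarrow> \<exists>y\<in>K0. dist x (z + y) \<le> e / 2"
        using cell[OF X_subset[OF elim(2)] z] by auto
      let ?C = "(+) (p - z) ` C"
      have body: "?C \<in> convex_bodies" using C(1) elim(1) by (auto intro: convex_body_translation)
      have "\<exists>c\<in>?C. dist x c \<le> e / 2" if "x \<in> K" for x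
      proof -
        have "z + (- p + x) \<in> C" using C(2) that by (auto simp: K0_def)
        then have "(p - z) + (z + (- p + x)) \<in> ?C" by (rule imageI)
        then show ?thesis using e by (intro bexI[of _ x]) auto
      qed
      moreover have "\<exists>x\<in>K. dist c x \<le> e / 2" if "c \<in> ?C" for c
      proof -
        obtain x where x: "x \<in> C" "c = (p - z) + x" using \<open>c \<in> ?C\<close> by blast
        obtain y where y: "y \<in> K" "dist x (z + (- p + y)) \<le> e / 2"
          using C(3)[OF x(1)] by (auto simp: K0_def)
        have "dist c y = dist x (z + (- p + y))" by (simp add: x(2) dist_norm algebra_simps)
        with y show ?thesis by (intro bexI[of _ y]) auto
      qed
      ultimately have "hausdorff_distance K ?C < e"
        unfolding hausdorff_distance_less_iff[OF K body]
        using e by (intro exI[of _ "e / 2"] conjI ballI) simp_all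
      moreover have "?C \<in> translates (cells (X \<omega>))" using C(1) by (auto simp: translates_def)
      ultimately show ?case by blast
    qed
  qed
qed

lemma AE_dense_translates:
  "AE \<omega> in M. dense_subset_of hausdorff_topology (translates (cells (X \<omega>)))"
proof -
  interpret H: Metric_space "convex_bodies :: 'a set set" hausdorff_distance
    by (rule Metric_space_hausdorff)
  obtain D :: "'a set" where D: "countable D" "\<And>U :: 'a set. open U \<Longrightarrow> U \<noteq> {} \<Longrightarrow> \<exists>d\<in>D. d \<in> U"
    using countable_dense_setE by blast
  let ?F = "{F. finite F \<and> F \<subseteq> D} - {{}}"
  have "countable ?F" by (intro countable_Diff countable_Collect_finite_subset D)
  moreover have "convex hull F \<in> convex_bodies" if "F \<in> ?F" for F
    using that by (simp add: convex_bodies_def finite_imp_compact_convex_hull convex_convex_hull)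
  ultimately have "AE \<omega> in M. \<forall>F\<in>?F. \<forall>n::nat. \<exists>C\<in>translates (cells (X \<omega>)).
      hausdorff_distance (convex hull F) C < 1 / Suc n"
    by (intro AE_ball_countable' AE_all_countable[THEN iffD2] allI AE_cell_close_to_body) auto
  with AE_cells_convex_bodies show ?thesis
  proof eventually_elim
    case (elim \<omega>)
    let ?T = "translates (cells (X \<omega>))"
    have sub: "?T \<subseteq> convex_bodies"
      using elim(1) convex_body_translation by (force simp: translates_def)
    have "\<exists>C\<in>?T. hausdorff_distance K C < r" if K: "K \<in> convex_bodies" and r: "r > 0" for K r
    proof -
      obtain F where F: "finite F" "F \<subseteq> D" "F \<noteq> {}" "hausdorff_distance K (convex hull F) < r / 2"
        using convex_hull_dense_in_convex_bodies[OF D(2) K, of "r / 2"] r by auto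
      obtain n where n: "1 / real (Suc n) < r / 2"
        using reals_Archimedean[of "r / 2"] r by (auto simp: inverse_eq_divide)
      have hull: "convex hull F \<in> convex_bodies"
        using F by (simp add: convex_bodies_def finite_imp_compact_convex_hull convex_convex_hull)
      obtain C where C: "C \<in> ?T" "hausdorff_distance (convex hull F) C < 1 / Suc n"
        using elim(2) F by blast
      have "hausdorff_distance K C \<le> hausdorff_distance K (convex hull F) + hausdorff_distance (convex hull F) C"
        using C(1) sub by (intro H.triangle K hull) auto
      with F(4) C(2) n have "hausdorff_distance K C < r" by linarith
      with C(1) show ?thesis by blast
    qed
    then have "H.mtopology closure_of ?T = convex_bodies"
      using sub unfolding H.metric_closure_of H.in_mball by blast
    with sub show ?case by (simp add: dense_subset_of_def hausdorff_topology_def)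
  qed
qed

end

theorem theorem1:
  fixes M :: "'w measure"
    and X :: "'w \<Rightarrow> 'a::euclidean_space set set"
    and \<phi> :: "'a measure"
  assumes "stationary_poisson_hyperplane_process M X"
    and "locally_finite_intensity M X"
    and "\<exists>A \<in> sets hyperplane_borel. intensity M X A \<noteq> 0"
    and "spherical_directional_distribution M X \<phi>"
    and "measure_support \<phi> = sphere 0 1"
    and "\<And>u. norm u = 1 \<Longrightarrow> emeasure \<phi> ({x. u \<bullet> x = 0} \<inter> sphere 0 1) = 0"
  shows "AE \<omega> in M. dense_subset_of hausdorff_topology (translates (cells (X \<omega>)))"
proof -
  have M: "prob_space M" "X \<in> measurable M system_space" "poisson_process M X"
    using assms(1) by (auto simp: stationary_poisson_hyperplane_process_def hyperplane_process_def)
  obtain \<gamma> where \<phi>: "prob_space \<phi>" "sets \<phi> = sets (restrict_space borel (sphere 0 1))"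
    and \<gamma>: "\<gamma> > 0" "\<And>A. A \<in> sets hyperplane_borel \<Longrightarrow> intensity M X A =
        ennreal \<gamma> * (\<integral>\<^sup>+u. (\<integral>\<^sup>+t. indicator A (hyperplane u t) \<partial>lborel) \<partial>\<phi>)"
    using assms(4) unfolding spherical_directional_distribution_def by blast
  interpret \<phi>: directional_distribution \<phi>
    using \<phi> assms(5,6) by (simp add: directional_distribution_def directional_distribution_axioms_def)
  interpret poisson_hyperplanes M \<phi> X \<gamma>
    using M \<gamma> \<phi>.directional_distribution_axioms
    by (simp add: poisson_hyperplanes_def poisson_hyperplanes_axioms_def \<phi>.emeasure_\<Lambda>_eq_integral)
  show ?thesis by (rule AE_dense_translates)
qed

end
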